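(* For every (nonempty) complete metric space $M$ there exists a complete metric space $N$ which is not purely $1$-unrectifiable, has the same density character as $M$, and is such that $N_{cf}$ is isometric to $M$.
   Context: The density character of a metric space is the smallest infinite cardinal $\kappa$ such that the space has a dense subset of cardinality at most $\kappa$ (so every separable space has density character $\aleph_0$). A metric space is purely $1$-unrectifiable if it contains no bi-Lipschitz copy of a subset of $\mathbb{R}$ of positive Lebesgue measure. A curve-fragment in a metric space $N$ is a Lipschitz map $\varphi\colon K\to N$ with $K\subset\mathbb{R}$ compact. For a metric space $(N,d)$ the curve-flat pseudometric is $d_{cf}(x,y)=\inf \lambda([\min K,\max K]\setminus K)$, the infimum being over all $1$-Lipschitz curve-fragments $\varphi\colon K\to N$ with $\varphi(\min K)=x$ and $\varphi(\max K)=y$, where $\lambda$ is Lebesgue measure. The curve-flat quotient $N_{cf}$ is the metric space obtained from $N$ by identifying points at $d_{cf}$-distance $0$, endowed with the metric induced by $d_{cf}$. *)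

theory Defs
  imports "HOL-Analysis.Analysis"
begin

unbundle cardinal_syntax

section \<open>Density character\<close>

definition dense_subset :: "'a metric \<Rightarrow> 'a set \<Rightarrow> bool" where
  "dense_subset m D \<longleftrightarrow> D \<subseteq> mspace m \<and> mtopology_of m closure_of D = mspace m"

text \<open>
  The density character is a cardinal, i.e. (as usual in HOL) a cardinal order \<open>\<kappa>\<close>,
  determined up to \<open>=o\<close>. Minimality only has to be tested against
  cardinals on the same type \<open>'k\<close>: cardinals are linearly ordered by \<open>\<le>o\<close>, and every
  cardinal below \<open>\<kappa>\<close> is represented on a subset of the field of \<open>\<kappa>\<close>.
\<close>
definition density_character :: "'a metric \<Rightarrow> 'k rel \<Rightarrow> bool" where
  "density_character m \<kappa> \<longleftrightarrow>
     Card_order \<kappa> \<and> cinfinite \<kappa> \<and> (\<exists>D. dense_subset m D \<and> |D| \<le>o \<kappa>) \<and>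
     (\<forall>\<kappa>' :: 'k rel. Card_order \<kappa>' \<and> cinfinite \<kappa>' \<and> (\<exists>D. dense_subset m D \<and> |D| \<le>o \<kappa>')
        \<longrightarrow> \<kappa> \<le>o \<kappa>')"

text \<open>The type \<open>'a + nat\<close> is large enough to carry the density character of
  every metric space over \<open>'a\<close>. A complete metric space with the same density character
  \<open>\<kappa>\<close> has at most \<open>\<kappa> ^c natLeq\<close> points, so up to isometry it lives on the type
  \<open>nat \<Rightarrow> 'a \<times> real\<close>.\<close>
lemma density_character_exists:
  fixes m :: "'a metric"
  shows "\<exists>\<kappa> :: ('a + nat) rel. density_character m \<kappa>"
proof -
  define R where "R = {\<kappa> :: ('a + nat) rel. Card_order \<kappa> \<and> cinfinite \<kappa> \<and>
    (\<exists>D. dense_subset m D \<and> |D| \<le>o \<kappa>)}"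
  have "dense_subset m (mspace m)"
    by (metis closure_of_topspace dense_subset_def order_refl topspace_mtopology_of)
  moreover have "|mspace m| \<le>o |UNIV :: ('a + nat) set|"
    by (rule card_of_ordLeqI[of Inl]) auto
  moreover have "cinfinite |UNIV :: ('a + nat) set|"
    by (simp add: cinfinite_def Field_card_of finite_Plus_UNIV_iff)
  ultimately have "R \<noteq> {}"
    unfolding R_def using card_of_Card_order by blast
  moreover have "\<forall>r\<in>R. Card_order r"
    by (simp add: R_def)
  ultimately obtain r where "r \<in> R" "\<forall>r'\<in>R. r \<le>o r'"
    using exists_minim_Card_order by blast
  then show ?thesis
    by (auto simp: density_character_def R_def intro!: exI[of _ r])
qed


section \<open>Pure 1-unrectifiability\<close>

definition bi_Lipschitz_on :: "real set \<Rightarrow> 'a metric \<Rightarrow> (real \<Rightarrow> 'a) \<Rightarrow> bool" where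
  "bi_Lipschitz_on A m f \<longleftrightarrow>
     f \<in> A \<rightarrow> mspace m \<and>
     (\<exists>c > 0. \<exists>C. \<forall>s\<in>A. \<forall>t\<in>A.
        c * \<bar>s - t\<bar> \<le> mdist m (f s) (f t) \<and> mdist m (f s) (f t) \<le> C * \<bar>s - t\<bar>)"

definition purely_1_unrectifiable :: "'a metric \<Rightarrow> bool" where
  "purely_1_unrectifiable m \<longleftrightarrow>
     \<not> (\<exists>A f. A \<in> sets lebesgue \<and> emeasure lebesgue A > 0 \<and> bi_Lipschitz_on A m f)"


section \<open>Curve-flat pseudometric and quotient\<close>

definition curve_fragment :: "'a metric \<Rightarrow> real set \<Rightarrow> (real \<Rightarrow> 'a) \<Rightarrow> bool" where
  "curve_fragment m K \<phi> \<longleftrightarrow>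
     compact K \<and> Lipschitz_continuous_map (submetric euclidean_metric K) m \<phi>"

definition one_Lipschitz_on :: "real set \<Rightarrow> 'a metric \<Rightarrow> (real \<Rightarrow> 'a) \<Rightarrow> bool" where
  "one_Lipschitz_on K m \<phi> \<longleftrightarrow> (\<forall>s\<in>K. \<forall>t\<in>K. mdist m (\<phi> s) (\<phi> t) \<le> \<bar>s - t\<bar>)"

text \<open>For nonempty compact \<open>K\<close>, \<open>Inf K\<close> and \<open>Sup K\<close> are its minimum and maximum.\<close>
definition cf_dist :: "'a metric \<Rightarrow> 'a \<Rightarrow> 'a \<Rightarrow> real" where
  "cf_dist m x y = Inf {measure lebesgue ({Inf K..Sup K} - K) |K \<phi>.
     K \<noteq> {} \<and> curve_fragment m K \<phi> \<and> one_Lipschitz_on K m \<phi> \<and>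
     \<phi> (Inf K) = x \<and> \<phi> (Sup K) = y}"

definition cf_rel :: "'a metric \<Rightarrow> 'a rel" where
  "cf_rel m = {(x, y). x \<in> mspace m \<and> y \<in> mspace m \<and> cf_dist m x y = 0}"

text \<open>The set below is a singleton for \<open>X, Y \<in> mspace m // cf_rel m\<close>
  (see \<open>cf_quotient_dist_class\<close>); elsewhere the value \<open>0\<close> is a
  placeholder, since \<open>Metric_space\<close> asks for a total nonnegative symmetric function.\<close>
definition cf_quotient_dist :: "'a metric \<Rightarrow> 'a set \<Rightarrow> 'a set \<Rightarrow> real" where
  "cf_quotient_dist m X Y =
     (if X \<in> mspace m // cf_rel m \<and> Y \<in> mspace m // cf_rel m
      then the_elem {cf_dist m x y |x y. x \<in> X \<and> y \<in> Y} else 0)"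

definition cf_quotient :: "'a metric \<Rightarrow> 'a set metric" where
  "cf_quotient m = metric (mspace m // cf_rel m, cf_quotient_dist m)"

definition isometric_to :: "'a metric \<Rightarrow> 'b metric \<Rightarrow> bool" where
  "isometric_to m1 m2 \<longleftrightarrow>
     (\<exists>f. bij_betw f (mspace m1) (mspace m2) \<and>
          (\<forall>x\<in>mspace m1. \<forall>y\<in>mspace m1. mdist m2 (f x) (f y) = mdist m1 x y))"


subsection \<open>The quotient is a metric space\<close>

definition cf_link :: "'a metric \<Rightarrow> real set \<Rightarrow> (real \<Rightarrow> 'a) \<Rightarrow> 'a \<Rightarrow> 'a \<Rightarrow> bool" where
  "cf_link m K \<phi> x y \<longleftrightarrow>
     K \<noteq> {} \<and> curve_fragment m K \<phi> \<and> one_Lipschitz_on K m \<phi> \<and>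
     \<phi> (Inf K) = x \<and> \<phi> (Sup K) = y"

abbreviation cf_gap :: "real set \<Rightarrow> real" where
  "cf_gap K \<equiv> measure lebesgue ({Inf K..Sup K} - K)"

lemma cf_dist_link: "cf_dist m x y = Inf {cf_gap K |K \<phi>. cf_link m K \<phi> x y}"
  by (simp add: cf_dist_def cf_link_def)

lemma cf_linkI:
  assumes "compact K" "a \<in> K" "b \<in> K" "\<And>t. t \<in> K \<Longrightarrow> a \<le> t \<and> t \<le> b"
    and "\<phi> \<in> K \<rightarrow> mspace m"
    and lip: "\<And>s t. s \<in> K \<Longrightarrow> t \<in> K \<Longrightarrow> s \<le> t \<Longrightarrow> mdist m (\<phi> s) (\<phi> t) \<le> t - s"
    and "\<phi> a = x" "\<phi> b = y"
  shows "cf_link m K \<phi> x y" "Inf K = a" "Sup K = b"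
proof -
  show inf: "Inf K = a" and sup: "Sup K = b"
    using assms by (auto intro!: cInf_eq_minimum cSup_eq_maximum)
  have one: "mdist m (\<phi> s) (\<phi> t) \<le> \<bar>s - t\<bar>" if "s \<in> K" "t \<in> K" for s t
    using lip[of s t] lip[of t s] that by (cases "s \<le> t") (auto simp: mdist_commute)
  then have "curve_fragment m K \<phi>"
    using assms(1,5)
    by (auto simp: curve_fragment_def Lipschitz_continuous_map_def dist_real_def
        intro!: exI[of _ 1])
  then show "cf_link m K \<phi> x y"
    using assms one inf sup by (auto simp: cf_link_def one_Lipschitz_on_def)
qed

lemma cf_linkD:
  assumes "cf_link m K \<phi> x y"
  shows "compact K" "Inf K \<in> K" "Sup K \<in> K" "\<And>t. t \<in> K \<Longrightarrow> Inf K \<le> t \<and> t \<le> Sup K"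
    "\<phi> \<in> K \<rightarrow> mspace m"
    "\<And>s t. s \<in> K \<Longrightarrow> t \<in> K \<Longrightarrow> mdist m (\<phi> s) (\<phi> t) \<le> \<bar>s - t\<bar>"
    "\<phi> (Inf K) = x" "\<phi> (Sup K) = y"
proof -
  have cf: "curve_fragment m K \<phi>" and lip: "one_Lipschitz_on K m \<phi>" and "K \<noteq> {}"
    using assms by (simp_all add: cf_link_def)
  show "\<phi> (Inf K) = x" "\<phi> (Sup K) = y"
    using assms by (simp_all add: cf_link_def)
  show K: "compact K" and "\<phi> \<in> K \<rightarrow> mspace m"
    using cf by (simp_all add: curve_fragment_def Lipschitz_continuous_map_def)
  show "mdist m (\<phi> s) (\<phi> t) \<le> \<bar>s - t\<bar>" if "s \<in> K" "t \<in> K" for s t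
    using lip that by (simp add: one_Lipschitz_on_def)
  have bdd: "bdd_below K" "bdd_above K" and "closed K"
    using K by (simp_all add: compact_imp_closed compact_imp_bounded
        bounded_imp_bdd_above bounded_imp_bdd_below)
  then show "Inf K \<in> K" "Sup K \<in> K"
    using \<open>K \<noteq> {}\<close> by (simp_all add: closed_contains_Inf closed_contains_Sup)
  show "Inf K \<le> t \<and> t \<le> Sup K" if "t \<in> K" for t
    using bdd that by (simp add: cInf_lower cSup_upper)
qed

lemma mdist_refl: "x \<in> mspace m \<Longrightarrow> mdist m x x = 0"
  by simp

lemma cf_link_refl:
  assumes "x \<in> mspace m"
  shows "cf_link m {0} (\<lambda>_. x) x x"
  by (rule cf_linkI(1)[of _ 0 0]) (use assms in \<open>auto simp: mdist_refl\<close>)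

lemma cf_link_exists:
  assumes "x \<in> mspace m" "y \<in> mspace m"
  shows "\<exists>K \<phi>. cf_link m K \<phi> x y"
proof (cases "x = y")
  case True
  then show ?thesis
    using cf_link_refl[OF assms(1)] by blast
next
  case False
  then have "mdist m x y > 0"
    using assms by (metis less_eq_real_def mdist_nonneg mdist_zero)
  then have "cf_link m {0, mdist m x y} (\<lambda>t. if t = 0 then x else y) x y"
    by (intro cf_linkI(1)[of _ 0 "mdist m x y"])
      (use assms in \<open>auto simp: mdist_refl mdist_commute split: if_splits\<close>)
  then show ?thesis by blast
qed

lemma cf_dist_le: "cf_link m K \<phi> x y \<Longrightarrow> cf_dist m x y \<le> cf_gap K"
  unfolding cf_dist_link
proof (rule cInf_lower)
  show "bdd_below {cf_gap K |K \<phi>. cf_link m K \<phi> x y}"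
    unfolding bdd_below_def by (rule exI[of _ 0]) (use measure_nonneg in blast)
qed blast

lemma cf_dist_approx:
  assumes "x \<in> mspace m" "y \<in> mspace m" "e > 0"
  obtains K \<phi> where "cf_link m K \<phi> x y" "cf_gap K < cf_dist m x y + e"
proof -
  let ?S = "{cf_gap K |K \<phi>. cf_link m K \<phi> x y}"
  have "?S \<noteq> {}"
    using cf_link_exists[OF assms(1,2)] by blast
  moreover have "Inf ?S < cf_dist m x y + e"
    using assms(3) by (simp add: cf_dist_link)
  ultimately obtain r where "r \<in> ?S" "r < cf_dist m x y + e"
    using cInf_lessD[of ?S "cf_dist m x y + e"] by blast
  with that show thesis by blast
qed

lemma cf_dist_nonneg:
  assumes "x \<in> mspace m" "y \<in> mspace m"
  shows "0 \<le> cf_dist m x y"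
  unfolding cf_dist_link
proof (rule cInf_greatest)
  show "{cf_gap K |K \<phi>. cf_link m K \<phi> x y} \<noteq> {}"
    using cf_link_exists[OF assms] by blast
qed (use measure_nonneg in blast)

lemma cf_dist_refl:
  assumes "x \<in> mspace m"
  shows "cf_dist m x x = 0"
proof -
  from cf_dist_le[OF cf_link_refl[OF assms]] cf_dist_nonneg[OF assms assms] show ?thesis by simp
qed

lemma cf_dist_commute_le:
  assumes "x \<in> mspace m" "y \<in> mspace m"
  shows "cf_dist m y x \<le> cf_dist m x y"
proof (rule field_le_epsilon)
  fix e :: real assume "e > 0"
  then obtain K \<phi> where l: "cf_link m K \<phi> x y" and gap: "cf_gap K < cf_dist m x y + e"
    using cf_dist_approx[OF assms] by blast
  note D = cf_linkD[OF l]
  let ?K = "uminus ` K" and ?\<phi> = "\<lambda>t. \<phi> (- t)"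
  have cpt: "compact ?K"
    using D(1) by (rule compact_negations)
  have ends: "- Sup K \<in> ?K" "- Inf K \<in> ?K"
    using D(2,3) by auto
  have bd: "- Sup K \<le> t \<and> t \<le> - Inf K" if "t \<in> ?K" for t
    using that D(4) by auto
  have sub: "?\<phi> \<in> ?K \<rightarrow> mspace m"
    using D(5) by auto
  have lip: "mdist m (?\<phi> s) (?\<phi> t) \<le> t - s" if "s \<in> ?K" "t \<in> ?K" "s \<le> t" for s t
    using that D(6)[of "- s" "- t"] by auto
  have vals: "?\<phi> (- Sup K) = y" "?\<phi> (- Inf K) = x"
    using D(7,8) by auto
  note r = cf_linkI[OF cpt ends bd sub lip vals]
  have inK: "t \<in> uminus ` A \<longleftrightarrow> - t \<in> A" for t and A :: "real set"
    by (force simp: image_iff)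
  have "{- Sup K..- Inf K} - ?K = uminus ` ({Inf K..Sup K} - K)"
    by (rule set_eqI) (auto simp: inK)
  then have "{Inf ?K..Sup ?K} - ?K = (\<lambda>t. (-1) *\<^sub>R t + 0) ` ({Inf K..Sup K} - K)"
    by (simp add: r)
  then have "cf_gap ?K = cf_gap K"
    using measure_lebesgue_affine[of "-1" 0 "{Inf K..Sup K} - K"] by simp
  with cf_dist_le[OF r(1)] gap show "cf_dist m y x \<le> cf_dist m x y + e" by linarith
qed

lemma cf_dist_commute:
  assumes "x \<in> mspace m" "y \<in> mspace m"
  shows "cf_dist m x y = cf_dist m y x"
  using assms by (simp add: antisym cf_dist_commute_le)

lemma lmeasurable_gap: "compact K \<Longrightarrow> {a..b} - K \<in> lmeasurable" for K :: "real set"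
  by (rule fmeasurable.Diff) (simp_all add: lmeasurable_compact)

lemma cf_link_concat:
  assumes l1: "cf_link m K \<phi> x y" and l2: "cf_link m L \<psi> y z"
  shows "\<exists>P \<theta>. cf_link m P \<theta> x z \<and> cf_gap P \<le> cf_gap K + cf_gap L"
proof -
  note D = cf_linkD[OF l1] and E = cf_linkD[OF l2]
  define c where "c = Sup K - Inf L"
  define P where "P = K \<union> (+) c ` L"
  define \<theta> where "\<theta> t = (if t \<le> Sup K then \<phi> t else \<psi> (t - c))" for t
  have inL: "t \<in> (+) c ` L \<longleftrightarrow> t - c \<in> L" for t
    by (force simp: image_iff)
  have chiL: "\<theta> t = \<psi> (t - c)" if "t - c \<in> L" for t
  proof (cases "t \<le> Sup K")
    case True
    then have "t = Sup K" using E(4)[OF that] by (simp add: c_def)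
    then show ?thesis by (simp add: \<theta>_def c_def D(8) E(7))
  qed (simp add: \<theta>_def)
  have chiK: "\<theta> t = \<phi> t" if "t \<in> K" for t
    using D(4)[OF that] by (simp add: \<theta>_def)
  have KL: "Inf K \<le> Sup K" "Inf L \<le> Sup L" using D(2,4) E(2,4) by auto
  have sub: "\<theta> \<in> P \<rightarrow> mspace m"
    using D(5) E(5) by (auto simp: P_def inL chiK chiL Pi_iff)
  have lip: "mdist m (\<theta> s) (\<theta> t) \<le> t - s" if st: "s \<in> P" "t \<in> P" "s \<le> t" for s t
  proof -
    consider "s \<in> K" "t \<in> K" | "s - c \<in> L" "t - c \<in> L" | "s \<in> K" "t - c \<in> L"
      | "s - c \<in> L" "t \<in> K"
      using st by (auto simp: P_def inL)
    then show ?thesis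
    proof cases
      case 1
      then show ?thesis using D(6)[of s t] st by (simp add: chiK)
    next
      case 2
      then show ?thesis using E(6)[of "s - c" "t - c"] st by (simp add: chiL)
    next
      case 3
      have "mdist m (\<phi> s) (\<psi> (t - c)) \<le> mdist m (\<phi> s) y + mdist m y (\<psi> (t - c))"
        using 3 D(3,5,8) E(5) by (intro mdist_triangle) auto
      moreover have "mdist m (\<phi> s) y \<le> Sup K - s"
        using D(6)[OF 3(1) D(3)] D(4)[OF 3(1)] D(8) by simp
      moreover have "mdist m y (\<psi> (t - c)) \<le> t - c - Inf L"
        using E(6)[OF E(2) 3(2)] E(4)[OF 3(2)] E(7) by simp
      ultimately show ?thesis using 3 by (simp add: chiK chiL c_def)
    next
      case 4
      then have "s = t" using D(4)[of t] E(4)[of "s - c"] st by (simp add: c_def)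
      moreover have "\<theta> t \<in> mspace m" using sub st by auto
      ultimately show ?thesis by (simp add: mdist_refl)
    qed
  qed
  have "cf_link m P \<theta> x z \<and> Inf P = Inf K \<and> Sup P = c + Sup L"
  proof (intro conjI)
    have cpt: "compact P"
      unfolding P_def using D(1) E(1) by (intro compact_Un compact_translation)
    have ends: "Inf K \<in> P" "c + Sup L \<in> P"
      using D(2) E(3) by (auto simp: P_def)
    have bd: "Inf K \<le> t \<and> t \<le> c + Sup L" if "t \<in> P" for t
      using that KL D(4)[of t] E(4)[of "t - c"] by (auto simp: P_def inL c_def)
    have vals: "\<theta> (Inf K) = x" "\<theta> (c + Sup L) = z"
      using chiK[OF D(2)] chiL[of "c + Sup L"] D(7) E(3,8) by auto
    note I = cf_linkI[OF cpt ends bd sub lip vals]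
    show "cf_link m P \<theta> x z" "Inf P = Inf K" "Sup P = c + Sup L"
      using I by auto
  qed
  then have P: "cf_link m P \<theta> x z" "Inf P = Inf K" "Sup P = c + Sup L" by auto
  have m1: "{Inf K..Sup K} - K \<in> lmeasurable" "{Inf L..Sup L} - L \<in> lmeasurable"
    using D(1) E(1) by (auto intro: lmeasurable_gap)
  have "{Inf P..Sup P} - P \<subseteq> ({Inf K..Sup K} - K) \<union> (+) c ` ({Inf L..Sup L} - L)"
  proof
    fix t assume t: "t \<in> {Inf P..Sup P} - P"
    show "t \<in> ({Inf K..Sup K} - K) \<union> (+) c ` ({Inf L..Sup L} - L)"
    proof (cases "t \<le> Sup K")
      case True
      then show ?thesis using t P by (auto simp: P_def)
    next
      case False
      then have "t - c \<in> {Inf L..Sup L} - L"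
        using t P(2,3) inL[of t] by (auto simp: P_def c_def)
      then have "c + (t - c) \<in> (+) c ` ({Inf L..Sup L} - L)" by (rule imageI)
      then show ?thesis by simp
    qed
  qed
  then have "cf_gap P \<le> measure lebesgue (({Inf K..Sup K} - K) \<union> (+) c ` ({Inf L..Sup L} - L))"
    using m1 cf_linkD(1)[OF P(1)]
    by (intro measure_mono_fmeasurable fmeasurable.Un measurable_translation)
      (auto intro!: fmeasurableD lmeasurable_gap)
  also have "\<dots> \<le> cf_gap K + measure lebesgue ((+) c ` ({Inf L..Sup L} - L))"
    using m1 by (intro measure_Un_le fmeasurableD measurable_translation)
  finally show ?thesis
    using P(1) by (auto simp: measure_translation)
qed

lemma cf_dist_triangle:
  assumes "x \<in> mspace m" "y \<in> mspace m" "z \<in> mspace m"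
  shows "cf_dist m x z \<le> cf_dist m x y + cf_dist m y z"
proof (rule field_le_epsilon)
  fix e :: real assume "e > 0"
  then have e: "e / 2 > 0" by simp
  obtain K \<phi> where l1: "cf_link m K \<phi> x y" and g1: "cf_gap K < cf_dist m x y + e / 2"
    using cf_dist_approx[OF assms(1,2) e] by blast
  obtain L \<psi> where l2: "cf_link m L \<psi> y z" and g2: "cf_gap L < cf_dist m y z + e / 2"
    using cf_dist_approx[OF assms(2,3) e] by blast
  obtain P \<theta> where "cf_link m P \<theta> x z" "cf_gap P \<le> cf_gap K + cf_gap L"
    using cf_link_concat[OF l1 l2] by blast
  with cf_dist_le[of m P \<theta> x z] g1 g2
  show "cf_dist m x z \<le> cf_dist m x y + cf_dist m y z + e" by linarith
qed

lemma equiv_cf_rel: "equiv (mspace m) (cf_rel m)"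
proof (rule equivI)
  show "cf_rel m \<subseteq> mspace m \<times> mspace m" by (auto simp: cf_rel_def)
  show "refl_on (mspace m) (cf_rel m)"
    by (auto simp: refl_on_def cf_rel_def cf_dist_refl)
  show "sym (cf_rel m)" by (auto simp: sym_def cf_rel_def cf_dist_commute)
  show "trans (cf_rel m)"
    unfolding trans_def cf_rel_def
  proof clarsimp
    fix x y z assume "x \<in> mspace m" "y \<in> mspace m" "z \<in> mspace m"
      "cf_dist m x y = 0" "cf_dist m y z = 0"
    then show "cf_dist m x z = 0"
      using cf_dist_triangle[of x m y z] cf_dist_nonneg[of x m z] by simp
  qed
qed

lemma cf_quotient_dist_class:
  assumes "X \<in> mspace m // cf_rel m" "Y \<in> mspace m // cf_rel m" "x \<in> X" "y \<in> Y"
  shows "cf_quotient_dist m X Y = cf_dist m x y"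
proof -
  have cl: "u \<in> mspace m \<and> v \<in> mspace m \<and> cf_dist m u v = 0 \<and> cf_dist m v u = 0"
    if "Z \<in> mspace m // cf_rel m" "u \<in> Z" "v \<in> Z" for Z u v
  proof -
    have "(u, v) \<in> cf_rel m"
      using quotient_eq_iff[OF equiv_cf_rel that(1,1,2,3)] by simp
    then show ?thesis by (auto simp: cf_rel_def cf_dist_commute)
  qed
  have "cf_dist m x' y' = cf_dist m x y" if "x' \<in> X" "y' \<in> Y" for x' y'
    using cl[OF assms(1) that(1) assms(3)] cl[OF assms(2) that(2) assms(4)]
      cf_dist_triangle[of x' m x y'] cf_dist_triangle[of x m y y']
      cf_dist_triangle[of x m x' y] cf_dist_triangle[of x' m y' y]
    by auto
  then have "{cf_dist m x y |x y. x \<in> X \<and> y \<in> Y} = {cf_dist m x y}"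
    using assms(3,4) by blast
  then show ?thesis using assms by (simp add: cf_quotient_dist_def)
qed

lemma Metric_space_cf_quotient: "Metric_space (mspace m // cf_rel m) (cf_quotient_dist m)"
proof -
  let ?Q = "mspace m // cf_rel m"
  have rep: "\<exists>x. x \<in> X \<and> x \<in> mspace m" if "X \<in> ?Q" for X
    using that in_quotient_imp_non_empty[OF equiv_cf_rel that]
      in_quotient_imp_subset[OF equiv_cf_rel that] by blast
  show ?thesis
  proof
    fix X Y
    show "0 \<le> cf_quotient_dist m X Y"
    proof (cases "X \<in> ?Q \<and> Y \<in> ?Q")
      case True
      then show ?thesis using rep[of X] rep[of Y] by (auto simp: cf_quotient_dist_class cf_dist_nonneg)
    qed (auto simp: cf_quotient_dist_def)
    show "cf_quotient_dist m X Y = cf_quotient_dist m Y X"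
    proof (cases "X \<in> ?Q \<and> Y \<in> ?Q")
      case True
      then show ?thesis using rep[of X] rep[of Y]
        by (auto simp: cf_quotient_dist_class cf_dist_commute)
    qed (auto simp: cf_quotient_dist_def)
  next
    fix X Y assume XY: "X \<in> ?Q" "Y \<in> ?Q"
    obtain x y where xy: "x \<in> X" "x \<in> mspace m" "y \<in> Y" "y \<in> mspace m"
      using rep XY by meson
    have "cf_quotient_dist m X Y = 0 \<longleftrightarrow> (x, y) \<in> cf_rel m"
      using xy XY by (simp add: cf_quotient_dist_class cf_rel_def)
    also have "\<dots> \<longleftrightarrow> X = Y"
      using quotient_eq_iff[OF equiv_cf_rel XY xy(1,3)] by simp
    finally show "cf_quotient_dist m X Y = 0 \<longleftrightarrow> X = Y" .
  next
    fix X Y Z assume XYZ: "X \<in> ?Q" "Y \<in> ?Q" "Z \<in> ?Q"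
    then obtain x y z where "x \<in> X" "x \<in> mspace m" "y \<in> Y" "y \<in> mspace m" "z \<in> Z" "z \<in> mspace m"
      using rep by meson
    with XYZ show "cf_quotient_dist m X Z \<le> cf_quotient_dist m X Y + cf_quotient_dist m Y Z"
      by (simp add: cf_quotient_dist_class cf_dist_triangle)
  qed
qed

lemma mspace_cf_quotient [simp]: "mspace (cf_quotient m) = mspace m // cf_rel m"
  by (simp add: cf_quotient_def Metric_space.mspace_metric Metric_space_cf_quotient)

lemma mdist_cf_quotient [simp]: "mdist (cf_quotient m) = cf_quotient_dist m"
  by (simp add: cf_quotient_def Metric_space.mdist_metric Metric_space_cf_quotient)

end

(*
  Let D be a dense subset of M whose cardinality is the density character. Equip M with the
  snowflake-type metric rho = d + 2 sqrt d. For s, t in D glue in a geodesic from s to t of length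
  rho s t and remove from its middle an open interval of length d s t. The resulting space N
  retracts onto M by sending each half edge to its end point ("foot"). Half edges are free for the
  curve-flat pseudometric and the hole of the edge costs d s t, so by density
  d_cf p q <= d (foot p) (foot q).
  Conversely, d (foot p) (foot q) <= (dist p q)^2 unless p and q lie on opposite halves of
  one edge, which are a positive distance apart. Hence, along a 1-Lipschitz curve fragment on K,
  t |-> d x (foot t) is 1-Lipschitz with derivative 0 within K, and so it can only increase by
  the measure of the gaps of K.
*)
theory Submission
  imports Defs
begin

section \<open>Curve fragments and functions of derivative zero\<close>

text \<open>Inside \<open>K\<close> the vanishing derivative allows only growth of rate
  \<open>e\<close>. Across a gap of \<open>K\<close> the Lipschitz bound allows at most the length
  of the gap. Compactness, in the form of the Bolzano bisection principle, adds up these local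
  bounds, and \<open>e\<close> then tends to 0.\<close>

lemma zero_derivative_on_compact_increment:
  fixes f :: "real \<Rightarrow> real"
  assumes K: "compact K" "K \<noteq> {}"
    and lip: "\<And>x y. x \<in> K \<Longrightarrow> y \<in> K \<Longrightarrow> \<bar>f x - f y\<bar> \<le> \<bar>x - y\<bar>"
    and der: "\<And>x. x \<in> K \<Longrightarrow> (f has_real_derivative 0) (at x within K)"
  shows "f (Sup K) - f (Inf K) \<le> measure lebesgue ({Inf K..Sup K} - K)"
proof -
  define a b where "a = Inf K" and "b = Sup K"
  have bdd: "bdd_below K" "bdd_above K" and "closed K"
    using K by (simp_all add: compact_imp_closed compact_imp_bounded
        bounded_imp_bdd_above bounded_imp_bdd_below)
  then have ab: "a \<in> K" "b \<in> K" "\<And>x. x \<in> K \<Longrightarrow> a \<le> x \<and> x \<le> b"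
    using K(2) by (simp_all add: a_def b_def closed_contains_Inf closed_contains_Sup cInf_lower cSup_upper)
  \<comment> \<open>The point \<open>pr t\<close> is the last point of \<open>K\<close> up to
    \<open>t\<close>; it makes interval endpoints that fall into a gap usable.\<close>
  have "\<exists>r. r \<in> K \<and> r \<le> t \<and> (\<forall>s\<in>K. s \<le> t \<longrightarrow> s \<le> r)" if "a \<le> t" for t
    using compact_attains_sup[OF compact_Int_closed[OF K(1) closed_atMost[of t]]] ab(1) that by auto
  then obtain pr where pr: "\<And>t. a \<le> t \<Longrightarrow> pr t \<in> K" "\<And>t. a \<le> t \<Longrightarrow> pr t \<le> t"
    "\<And>t s. a \<le> t \<Longrightarrow> s \<in> K \<Longrightarrow> s \<le> t \<Longrightarrow> s \<le> pr t"
    by metis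
  define G where "G t = measure lebesgue ({a..t} - K)" for t
  have meas: "{a..t} - K \<in> lmeasurable" for t
    by (rule lmeasurable_gap[OF K(1)])
  have G_mono: "G u \<le> G v" if "u \<le> v" for u v
    unfolding G_def using that meas by (intro measure_mono_fmeasurable) (auto intro: fmeasurableD)
  have G_gap: "v - u \<le> G v - G u" if "a \<le> u" "u \<le> v" "\<And>s. s \<in> K \<Longrightarrow> s \<le> u \<or> v \<le> s" for u v
  proof -
    have "G u + (v - u) = measure lebesgue (({a..u} - K) \<union> {u<..<v})"
      unfolding G_def using meas that by (subst measure_Un_AE) (auto simp: lmeasurable_interval)
    also have "\<dots> \<le> G v"
      unfolding G_def using that meas
      by (intro measure_mono_fmeasurable fmeasurableD fmeasurable.Un) (auto dest: that(3))
    finally show ?thesis by simp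
  qed
  have *: "f b - f a \<le> G b + e * (b - a)" if e: "e > 0" for e
  proof -
    \<comment> \<open>\<open>Q\<close> is transitive and holds locally, with the function \<open>f\<close> extended to the gaps as a constant
      from the left; \<open>G\<close> pays for the jumps at the right ends of the gaps.\<close>
    define Q where "Q u v \<longleftrightarrow> (a \<le> u \<longrightarrow> v \<le> b \<longrightarrow>
        f (pr v) - f (pr u) \<le> G (pr v) - G (pr u) + e * (pr v - pr u))" for u v
    have "Q a b"
    proof (rule Bolzano)
      show "a \<le> b" using ab by blast
      show "Q u w" if "Q u v" "Q v w" "u \<le> v" "v \<le> w" for u v w
        using that by (auto simp: Q_def algebra_simps)
      fix x assume x: "a \<le> x" "x \<le> b"
      show "\<exists>\<delta>>0. \<forall>u v. u \<le> x \<and> x \<le> v \<and> v - u < \<delta> \<longrightarrow> Q u v"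
      proof (cases "x \<in> K")
        case False
        then obtain \<delta> where \<delta>: "\<delta> > 0" "\<And>s. s \<in> K \<Longrightarrow> \<delta> \<le> \<bar>s - x\<bar>"
          using \<open>closed K\<close> separate_point_closed[of K x] by (auto simp: dist_real_def abs_minus_commute)
        \<comment> \<open>An interval around \<open>x\<close> shorter than the distance from
          \<open>x\<close> to \<open>K\<close> misses \<open>K\<close>, so both ends have the same
          last point.\<close>
        have "Q u v" if "u \<le> x" "x \<le> v" "v - u < \<delta>" for u v
          unfolding Q_def
        proof (intro impI)
          assume uv: "a \<le> u" "v \<le> b"
          have "pr v \<le> u" "pr u \<le> v"
            using \<delta>(2)[of "pr v"] pr(1,2)[of v] pr(2)[of u] uv that by (auto simp: abs_if split: if_splits)
          then have "pr u = pr v" using pr(3)[of u "pr v"] pr(3)[of v "pr u"] pr(1)[of u] pr(1)[of v] uv that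
            by auto
          then show "f (pr v) - f (pr u) \<le> G (pr v) - G (pr u) + e * (pr v - pr u)" by simp
        qed
        then show ?thesis using \<delta>(1) by blast
      next
        case True
        obtain \<delta> where \<delta>: "\<delta> > 0" "\<And>y. y \<in> K \<Longrightarrow> \<bar>y - x\<bar> < \<delta> \<Longrightarrow> \<bar>f y - f x\<bar> \<le> e * \<bar>y - x\<bar>"
          using der[OF True] e unfolding has_field_derivative_def has_derivative_within_alt by auto
        have "Q u v" if uv: "u \<le> x" "x \<le> v" "v - u < \<delta>" for u v
          unfolding Q_def
        proof (intro impI)
          assume *: "a \<le> u" "v \<le> b"
          \<comment> \<open>With \<open>w\<close> the first point of \<open>K\<close> from
            \<open>u\<close> on, the way from \<open>pr u\<close> to \<open>pr v\<close> is cut at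
            \<open>w\<close> and \<open>x\<close>. The first piece is a gap (possibly empty), paid
            by \<open>G\<close>; the other two are paid by the derivative at
            \<open>x\<close>.\<close>
          obtain w where w: "w \<in> K" "u \<le> w" "\<And>s. s \<in> K \<Longrightarrow> u \<le> s \<Longrightarrow> w \<le> s"
            using compact_attains_inf[OF compact_Int_closed[OF K(1) closed_atLeast[of u]]] True uv by auto
          have wx: "w \<le> x" using w True uv by auto
          have p: "pr v \<in> K" "x \<le> pr v" "pr v \<le> v" "pr u \<in> K" "pr u \<le> u"
            using pr[of v] pr[of u] * uv True x by auto
          have gap: "w - pr u \<le> G w - G (pr u)"
          proof (rule G_gap)
            fix s assume "s \<in> K" then show "s \<le> pr u \<or> w \<le> s"
              using w(3)[of s] pr(3)[of u s] * by linarith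
          qed (use ab(3) p w in auto)
          have "f w - f (pr u) \<le> w - pr u"
            using lip[OF w(1) p(4)] p w by linarith
          moreover have "f x - f w \<le> e * (x - w)"
            using \<delta>(2)[OF w(1)] w wx uv by auto
          moreover have "f (pr v) - f x \<le> e * (pr v - x)"
            using \<delta>(2)[OF p(1)] p uv by auto
          moreover have "G w \<le> G (pr v)" using G_mono p wx by simp
          moreover have "0 \<le> e * (w - pr u)" using e p w by simp
          ultimately show "f (pr v) - f (pr u) \<le> G (pr v) - G (pr u) + e * (pr v - pr u)"
            using gap by (simp add: algebra_simps)
        qed
        then show ?thesis using \<delta>(1) by blast
      qed
    qed
    moreover have "pr a = a" "pr b = b"
      using pr[of a] pr[of b] ab(1,2) ab(3)[OF ab(1)] ab(3)[of "pr a"] ab(3)[of "pr b"] ab(3)[OF ab(2)]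
      by (auto intro: antisym)
    moreover have "0 \<le> G a" by (simp add: G_def)
    ultimately show ?thesis by (simp add: Q_def)
  qed
  have "f b - f a \<le> G b"
  proof (rule field_le_epsilon)
    fix e :: real assume e: "e > 0"
    have "b - a \<ge> 0" using ab by simp
    \<comment> \<open>The summand 1 covers the case \<open>a = b\<close>.\<close>
    then have "e / (b - a + 1) * (b - a) \<le> e" using e by (simp add: field_simps)
    then show "f b - f a \<le> G b + e" using *[of "e / (b - a + 1)"] e \<open>b - a \<ge> 0\<close> by simp
  qed
  then show ?thesis by (simp add: G_def a_def b_def)
qed

text \<open>A jump is a curve fragment on two points, and its only gap is as long as the
  jump.\<close>

lemma cf_dist_le_mdist:
  assumes "x \<in> mspace m" "y \<in> mspace m"
  shows "cf_dist m x y \<le> mdist m x y"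
proof (cases "x = y")
  case True
  then show ?thesis using assms by (simp add: cf_dist_refl)
next
  case False
  let ?r = "mdist m x y"
  have r: "?r > 0"
    using False assms by (metis less_eq_real_def mdist_nonneg mdist_zero)
  have l: "cf_link m {0, ?r} (\<lambda>t. if t = 0 then x else y) x y"
    using r by (intro cf_linkI(1)[of _ 0 ?r])
      (use assms in \<open>auto simp: mdist_refl mdist_commute split: if_splits\<close>)
  have ends: "Inf {0, ?r} = 0" "Sup {0, ?r} = ?r"
    using r by (auto intro!: cInf_eq_minimum cSup_eq_maximum)
  have "cf_dist m x y \<le> measure lebesgue ({0..?r} - {0, ?r})"
    using cf_dist_le[OF l] ends by simp
  also have "\<dots> \<le> measure lebesgue {0..?r}"
    by (rule measure_mono_fmeasurable) (auto intro!: fmeasurableD lmeasurable_gap)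
  also have "\<dots> = ?r" using r by simp
  finally show ?thesis .
qed

text \<open>Two points are identified exactly when \<open>h\<close> agrees on them, so
  \<open>h\<close> at an arbitrary representative of each class is an isometry; this reduces the
  quotient to a formula for \<open>cf_dist\<close>.\<close>

lemma isometric_to_cf_quotient:
  assumes "\<And>p. p \<in> mspace N \<Longrightarrow> h p \<in> mspace M"
    and surj: "\<And>x. x \<in> mspace M \<Longrightarrow> \<exists>p\<in>mspace N. h p = x"
    and cf: "\<And>p q. p \<in> mspace N \<Longrightarrow> q \<in> mspace N \<Longrightarrow> cf_dist N p q = mdist M (h p) (h q)"
  shows "isometric_to (cf_quotient N) M"
proof -
  let ?Q = "mspace N // cf_rel N"
  define f where "f X = h (SOME p. p \<in> X)" for X
  have rep: "(SOME p. p \<in> X) \<in> X" "(SOME p. p \<in> X) \<in> mspace N" if "X \<in> ?Q" for X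
  proof -
    show "(SOME p. p \<in> X) \<in> X"
      using in_quotient_imp_non_empty[OF equiv_cf_rel that] by (simp add: some_in_eq)
    then show "(SOME p. p \<in> X) \<in> mspace N"
      using in_quotient_imp_subset[OF equiv_cf_rel that] by blast
  qed
  have dist: "mdist M (f X) (f Y) = cf_quotient_dist N X Y" if "X \<in> ?Q" "Y \<in> ?Q" for X Y
    using cf_quotient_dist_class[OF that rep(1)[OF that(1)] rep(1)[OF that(2)]]
      cf[OF rep(2)[OF that(1)] rep(2)[OF that(2)]] by (simp add: f_def)
  have fM: "f X \<in> mspace M" if "X \<in> ?Q" for X
    using assms(1) rep(2)[OF that] by (simp add: f_def)
  interpret Q: Metric_space ?Q "cf_quotient_dist N" by (rule Metric_space_cf_quotient)
  have "inj_on f ?Q"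
  proof (rule inj_onI)
    fix X Y assume XY: "X \<in> ?Q" "Y \<in> ?Q" "f X = f Y"
    then have "cf_quotient_dist N X Y = 0" using dist[of X Y] fM by (simp add: mdist_refl)
    then show "X = Y" using Q.zero[OF XY(1,2)] by blast
  qed
  moreover have "f ` ?Q = mspace M"
  proof (intro equalityI subsetI)
    fix x assume x: "x \<in> mspace M"
    then obtain p where p: "p \<in> mspace N" "h p = x" using surj by blast
    define X where "X = cf_rel N `` {p}"
    have X: "X \<in> ?Q" "p \<in> X"
      using p(1) equiv_class_self[OF equiv_cf_rel] by (auto simp: X_def quotientI)
    define q where "q = (SOME p. p \<in> X)"
    have q: "q \<in> X" "q \<in> mspace N" using rep[OF X(1)] by (auto simp: q_def)
    then have "cf_dist N p q = 0" by (auto simp: X_def cf_rel_def)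
    then have "mdist M x (h q) = 0" using cf[OF p(1) q(2)] p(2) by simp
    then have "f X = x" using assms(1)[OF q(2)] x by (simp add: f_def q_def)
    then show "x \<in> f ` ?Q" using X(1) by blast
  qed (use fM in auto)
  ultimately show ?thesis
    unfolding isometric_to_def
    by (intro exI[of _ f]) (simp add: bij_betw_def dist)
qed

lemma dense_subset_iff:
  "dense_subset m E \<longleftrightarrow> E \<subseteq> mspace m \<and> (\<forall>x\<in>mspace m. \<forall>e>0. \<exists>y\<in>E. mdist m x y < e)"
proof (cases "E \<subseteq> mspace m")
  case True
  have "mtopology_of m closure_of E = {x \<in> mspace m. \<forall>r>0. \<exists>y\<in>E. mdist m x y < r}"
    unfolding mtopology_of_def
      Metric_space.metric_closure_of[OF Metric_space_mspace_mdist]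
      Metric_space.in_mball[OF Metric_space_mspace_mdist]
    using True by blast
  then show ?thesis
    using True unfolding dense_subset_def by (simp only: set_eq_subset) blast
qed (simp add: dense_subset_def)

section \<open>Gluing punctured edges to a snowflake\<close>

text \<open>\<open>mk s t u\<close> encodes the point at distance \<open>u\<close> from \<open>s\<close> on the edge from \<open>s\<close> to \<open>t\<close>;
  the points \<open>x\<close> of the given space become \<open>mk x x 0\<close>.\<close>
definition mk :: "'a \<Rightarrow> 'a \<Rightarrow> real \<Rightarrow> nat \<Rightarrow> 'a \<times> real" where
  "mk s t u = (\<lambda>n. if n = 0 then (s, u) else (t, 0))"

definition src :: "(nat \<Rightarrow> 'a \<times> real) \<Rightarrow> 'a" where "src p = fst (p 0)"
definition tgt :: "(nat \<Rightarrow> 'a \<times> real) \<Rightarrow> 'a" where "tgt p = fst (p 1)"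
definition ht :: "(nat \<Rightarrow> 'a \<times> real) \<Rightarrow> real" where "ht p = snd (p 0)"

lemma mk_simps [simp]: "src (mk s t u) = s" "tgt (mk s t u) = t" "ht (mk s t u) = u"
  by (simp_all add: mk_def src_def tgt_def ht_def)

text \<open>Edges are glued only between points of \<open>D\<close>: edges between all pairs of
  points could raise the density character.\<close>

locale edge_space = Metric_space M d for M :: "'a set" and d +
  fixes D :: "'a set"
  assumes D_sub: "D \<subseteq> M"
begin

text \<open>The summands are the parts of an edge with distinct ends: a hole of length
  \<open>d x y\<close> between two halves of length \<open>sqrt (d x y)\<close>.\<close>

definition rho :: "'a \<Rightarrow> 'a \<Rightarrow> real" where "rho x y = d x y + 2 * sqrt (d x y)"
text \<open>Also loops \<open>s = t\<close> are allowed, of length 2 and cut after the first half, so that there is a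
  segment even if the given space is a single point.\<close>
definition rad :: "'a \<Rightarrow> 'a \<Rightarrow> real" where "rad s t = (if s = t then 1 else sqrt (d s t))"
definition len :: "'a \<Rightarrow> 'a \<Rightarrow> real" where "len s t = d s t + 2 * rad s t"

definition slots :: "'a \<Rightarrow> 'a \<Rightarrow> real set" where
  "slots s t = {0..rad s t} \<union> (if s = t then {} else {rad s t + d s t..len s t})"

text \<open>The strict bounds on \<open>u\<close> give every point one code: the ends of an edge
  occur only as base points \<open>mk x x 0\<close>. The base point of \<open>s\<close> is thus also
  the point of height 0 on the loop at \<open>s\<close>.\<close>

definition P :: "(nat \<Rightarrow> 'a \<times> real) set" where
  "P = {mk x x 0 |x. x \<in> M} \<union>
       {mk s t u |s t u. s \<in> D \<and> t \<in> D \<and> u \<in> slots s t \<and> 0 < u \<and> u < len s t}"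

text \<open>Distances to the two ends of the edge; the absolute values only matter outside \<open>P\<close>, where
  they keep \<open>glue_dist\<close> nonnegative.\<close>
definition near :: "(nat \<Rightarrow> 'a \<times> real) \<Rightarrow> real" where "near p = \<bar>ht p\<bar>"
definition far :: "(nat \<Rightarrow> 'a \<times> real) \<Rightarrow> real" where "far p = \<bar>len (src p) (tgt p) - ht p\<bar>"

text \<open>A path that leaves the edge of \<open>p\<close> passes through one of its ends; each end
  is paired with the price of reaching it.\<close>

definition exits :: "(nat \<Rightarrow> 'a \<times> real) \<Rightarrow> ('a \<times> real) set" where
  "exits p = {(src p, near p), (tgt p, far p)}"

definition detour :: "(nat \<Rightarrow> 'a \<times> real) \<Rightarrow> (nat \<Rightarrow> 'a \<times> real) \<Rightarrow> real" where
  "detour p q = min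
     (min (near p + rho (src p) (src q) + near q) (near p + rho (src p) (tgt q) + far q))
     (min (far p + rho (tgt p) (src q) + near q) (far p + rho (tgt p) (tgt q) + far q))"

definition same_edge :: "(nat \<Rightarrow> 'a \<times> real) \<Rightarrow> (nat \<Rightarrow> 'a \<times> real) \<Rightarrow> bool" where
  "same_edge p q \<longleftrightarrow> src p = src q \<and> tgt p = tgt q"

text \<open>A minimum with \<open>detour\<close> on a common edge would change nothing, by
  \<open>detour_ge_same\<close>. Heights are also compared across the hole, whose length thus
  counts.\<close>

definition glue_dist :: "(nat \<Rightarrow> 'a \<times> real) \<Rightarrow> (nat \<Rightarrow> 'a \<times> real) \<Rightarrow> real" where
  "glue_dist p q = (if same_edge p q then \<bar>ht p - ht q\<bar> else detour p q)"

definition foot :: "(nat \<Rightarrow> 'a \<times> real) \<Rightarrow> 'a" where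
  "foot p = (if ht p \<le> rad (src p) (tgt p) then src p else tgt p)"

section \<open>The glued metric\<close>

lemma rho_nonneg [simp]: "0 \<le> rho x y" by (simp add: rho_def)
lemma rho_commute: "rho x y = rho y x" by (simp add: rho_def commute)
lemma rho_refl [simp]: "x \<in> M \<Longrightarrow> rho x x = 0" by (simp add: rho_def)

lemma sqrt_triangle:
  assumes "x \<in> M" "y \<in> M" "z \<in> M"
  shows "sqrt (d x z) \<le> sqrt (d x y) + sqrt (d y z)"
  by (rule order_trans[OF real_sqrt_le_mono[OF triangle[OF assms]]]) (simp add: sqrt_add_le_add_sqrt)

lemma rho_triangle: "x \<in> M \<Longrightarrow> y \<in> M \<Longrightarrow> z \<in> M \<Longrightarrow> rho x z \<le> rho x y + rho y z"
  using triangle[of x y z] sqrt_triangle[of x y z] by (simp add: rho_def)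

text \<open>The bound on \<open>2 * ht p\<close> matters for loops: there \<open>rho\<close>
  vanishes and the length is 2, but heights stop at 1, so going round the loop is no
  shortcut.\<close>

lemma P_facts:
  assumes "p \<in> P"
  shows "src p \<in> M" "tgt p \<in> M" "0 \<le> ht p" "ht p < len (src p) (tgt p)"
    "near p = ht p" "far p = len (src p) (tgt p) - ht p" "0 < far p"
    "2 * ht p \<le> len (src p) (tgt p) + rho (src p) (tgt p)"
    "rho (src p) (tgt p) \<le> len (src p) (tgt p)"
    "ht p = 0 \<Longrightarrow> src p = tgt p"
    "p = mk (src p) (tgt p) (ht p)"
  using assms D_sub
  by (auto simp: P_def near_def far_def len_def rad_def rho_def slots_def split: if_splits)

lemma detour_le:
  "detour p q \<le> near p + rho (src p) (src q) + near q"
  "detour p q \<le> near p + rho (src p) (tgt q) + far q"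
  "detour p q \<le> far p + rho (tgt p) (src q) + near q"
  "detour p q \<le> far p + rho (tgt p) (tgt q) + far q"
  by (auto simp: detour_def)

lemma detour_cases:
  obtains a e b f where "(e, a) \<in> exits p" "(f, b) \<in> exits q" "detour p q = a + rho e f + b"
proof -
  have "detour p q \<in> {near p + rho (src p) (src q) + near q, near p + rho (src p) (tgt q) + far q,
     far p + rho (tgt p) (src q) + near q, far p + rho (tgt p) (tgt q) + far q}"
    unfolding detour_def min_def by (simp split del: if_split) auto
  then show thesis using that unfolding exits_def by blast
qed

lemma detour_leI:
  assumes "(e, a) \<in> exits p" "(f, b) \<in> exits q"
  shows "detour p q \<le> a + rho e f + b"
  using assms detour_le[of p q] by (auto simp: exits_def)

lemma detour_commute: "detour p q = detour q p"
  by (simp add: detour_def rho_commute ac_simps)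

lemma exit_facts:
  assumes "p \<in> P" "(e, a) \<in> exits p"
  shows "e \<in> M" "0 \<le> a"
  using assms P_facts[OF assms(1)] by (auto simp: exits_def)

text \<open>The two exits of \<open>p\<close> together cost the length of its edge, which is at
  least the \<open>rho\<close>-distance of the ends.\<close>

lemma exit_rho:
  assumes "p \<in> P" "(e, a) \<in> exits p"
    "(f, b) \<in> exits p"
  shows "rho e f \<le> a + b"
  using assms(2,3) P_facts[OF assms(1)] rho_commute[of "src p" "tgt p"] by (auto simp: exits_def)

lemma same_edge_sym: "same_edge p q \<longleftrightarrow> same_edge q p" by (auto simp: same_edge_def)
lemma same_edge_trans: "same_edge p q \<Longrightarrow> same_edge q r \<Longrightarrow> same_edge p r" by (auto simp: same_edge_def)

lemma detour_ge_same:
  assumes "p \<in> P" "r \<in> P" "same_edge p r"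
  shows "\<bar>ht p - ht r\<bar> \<le> detour p r"
  using P_facts[OF assms(1)] P_facts[OF assms(2)] assms(3) rho_commute[of "src p" "tgt p"]
  unfolding detour_def same_edge_def by (auto simp: min_def split: if_splits)

text \<open>Two optimal detours are concatenated. Their visit to \<open>q\<close>, in through one
  exit and out through another, can be replaced by a direct \<open>rho\<close>-step between these
  exits, by \<open>exit_rho\<close>.\<close>

lemma detour_triangle:
  assumes "p \<in> P" "q \<in> P" "r \<in> P"
  shows "detour p r \<le> detour p q + detour q r"
proof -
  obtain a e b f where 1: "(e, a) \<in> exits p"
    "(f, b) \<in> exits q" "detour p q = a + rho e f + b"
    by (rule detour_cases)
  obtain a' e' b' f' where 2: "(e', a') \<in> exits q"
    "(f', b') \<in> exits r" "detour q r = a' + rho e' f' + b'"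
    by (rule detour_cases)
  have "e \<in> M" "f \<in> M" "e' \<in> M" "f' \<in> M"
    using exit_facts 1 2 assms by blast+
  then have "rho e f' \<le> rho e f + rho f e' + rho e' f'"
    using rho_triangle[of e f f'] rho_triangle[of f e' f'] by linarith
  moreover have "rho f e' \<le> b + a'" using exit_rho[OF assms(2) 1(2) 2(1)] .
  ultimately show ?thesis using detour_leI[OF 1(1) 2(2)] 1(3) 2(3) by linarith
qed

text \<open>The exit that is best for \<open>q\<close> is also an exit of \<open>p\<close>, after
  sliding along the common edge.\<close>

lemma detour_triangle_same:
  assumes "p \<in> P" "q \<in> P" "r \<in> P" "same_edge p q"
  shows "detour p r \<le> \<bar>ht p - ht q\<bar> + detour q r"
proof -
  obtain a e b f where 1: "(e, a) \<in> exits q"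
    "(f, b) \<in> exits r" "detour q r = a + rho e f + b"
    by (rule detour_cases)
  have "(e, near p) \<in> exits p \<and> near p \<le> \<bar>ht p - ht q\<bar> + a \<or>
      (e, far p) \<in> exits p \<and> far p \<le> \<bar>ht p - ht q\<bar> + a"
    using 1(1) assms(4) P_facts(5,6)[OF assms(1)] P_facts(5,6)[OF assms(2)]
    by (auto simp: exits_def same_edge_def)
  then obtain a' where 2: "(e, a') \<in> exits p" "a' \<le> \<bar>ht p - ht q\<bar> + a"
    by blast
  show ?thesis using detour_leI[OF 2(1) 1(2)] 1(3) 2(2) by linarith
qed

lemma glue_dist_triangle:
  assumes "p \<in> P" "q \<in> P" "r \<in> P"
  shows "glue_dist p r \<le> glue_dist p q + glue_dist q r"
proof -
  consider "same_edge p q" "same_edge q r" "same_edge p r"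
    | "same_edge p q" "\<not> same_edge q r" "\<not> same_edge p r"
    | "\<not> same_edge p q" "same_edge r q" "same_edge q r" "\<not> same_edge p r"
    | "\<not> same_edge p q" "\<not> same_edge q r"
    using same_edge_trans same_edge_sym by blast
  then show ?thesis
  proof cases
    case 1
    then show ?thesis by (simp add: glue_dist_def)
  next
    case 2
    then show ?thesis using detour_triangle_same[OF assms 2(1)] by (simp add: glue_dist_def)
  next
    case 3
    then show ?thesis using detour_triangle_same[OF assms(3,2,1) 3(2)]
      by (simp add: glue_dist_def detour_commute[of r p] detour_commute[of q p])
  next
    case 4
    \<comment> \<open>Here \<open>p\<close> and \<open>r\<close> may still share an edge that the
      path through \<open>q\<close> leaves and enters again.\<close>
    then show ?thesis using detour_triangle[OF assms] detour_ge_same[OF assms(1,3)]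
      by (auto simp: glue_dist_def)
  qed
qed

lemma glue_dist_eq_0:
  assumes "p \<in> P" "q \<in> P"
  shows "glue_dist p q = 0 \<longleftrightarrow> p = q"
proof
  assume 0: "glue_dist p q = 0"
  show "p = q"
  proof (cases "same_edge p q")
    case True
    then show ?thesis using 0 P_facts(11)[OF assms(1)] P_facts(11)[OF assms(2)]
      by (auto simp: glue_dist_def same_edge_def)
  next
    case False
    obtain a e b f where 1: "(e, a) \<in> exits p"
      "(f, b) \<in> exits q" "detour p q = a + rho e f + b"
      by (rule detour_cases)
    have "a + rho e f + b = 0"
      using 0 False 1(3) by (simp add: glue_dist_def)
    then have "a = 0" "rho e f = 0" "b = 0"
      using exit_facts[OF assms(1) 1(1)] exit_facts[OF assms(2) 1(2)] rho_nonneg[of e f]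
      by linarith+
    moreover from this have "e = f"
      using exit_facts[OF assms(1) 1(1)] exit_facts[OF assms(2) 1(2)] zero[of e f]
      by (simp add: rho_def add_nonneg_eq_0_iff)
    \<comment> \<open>Since \<open>far\<close> is positive on \<open>P\<close>, an exit of price 0
      forces height 0, hence a base point; both points are then the base point of
      \<open>e = f\<close>.\<close>
    ultimately show ?thesis using 1(1,2) P_facts[OF assms(1)] P_facts[OF assms(2)] by (auto simp: exits_def)
  qed
next
  assume "p = q" then show "glue_dist p q = 0" by (simp add: glue_dist_def same_edge_def)
qed

sublocale pm: Metric_space P glue_dist
proof
  show "0 \<le> glue_dist p q" for p q by (auto simp: glue_dist_def detour_def near_def far_def)
  show "glue_dist p q = glue_dist q p" for p q
    using detour_commute same_edge_sym by (simp add: glue_dist_def abs_minus_commute)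
qed (use glue_dist_triangle glue_dist_eq_0 in auto)

section \<open>The retraction \<open>foot\<close> onto the given space\<close>

lemma P_E:
  assumes "p \<in> P"
  obtains (base) x where "x \<in> M" "p = mk x x 0"
  | (first) s t u where "s \<in> D" "t \<in> D" "0 < u" "u \<le> rad s t" "u < len s t" "p = mk s t u"
  | (second) s t u where "s \<in> D" "t \<in> D" "s \<noteq> t" "rad s t < u" "rad s t + d s t \<le> u" "u < len s t"
      "p = mk s t u"
proof (cases "\<exists>x\<in>M. p = mk x x 0")
  case False
  then obtain s t u where *: "s \<in> D" "t \<in> D" "u \<in> slots s t" "0 < u" "u < len s t" "p = mk s t u"
    using assms by (auto simp: P_def)
  show thesis
  proof (cases "u \<le> rad s t")
    case True
    then show thesis using first * by blast
  next
    case False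
    then show thesis using second[of s t u] * by (auto simp: slots_def split: if_splits)
  qed
qed (use base in blast)

lemma base_in: "x \<in> M \<Longrightarrow> mk x x 0 \<in> P" by (auto simp: P_def)

lemma foot_base [simp]: "foot (mk x x u) = x" by (simp add: foot_def)

lemma foot_in: "p \<in> P \<Longrightarrow> foot p \<in> M"
  using P_facts(1,2) by (simp add: foot_def)

text \<open>The exit at the foot itself is trivial. The opposite exit of an edge from
  \<open>s\<close> to \<open>t\<close> lies beyond the hole and the other half, so it costs at least
  \<open>d s t + sqrt (d s t)\<close>. On a loop both exits are the foot.\<close>

lemma foot_exit:
  assumes "p \<in> P" "(e, a) \<in> exits p"
  shows "d (foot p) e \<le> a" "sqrt (d (foot p) e) \<le> a"
proof -
  have "d (foot p) e \<le> a \<and> sqrt (d (foot p) e) \<le> a"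
    using assms(1)
  proof (cases rule: P_E)
    case (base x)
    then show ?thesis using assms(2) by (auto simp: exits_def near_def far_def)
  next
    case (first s t u)
    then have "s \<in> M" "t \<in> M" using D_sub by auto
    with first show ?thesis using assms(2) nonneg[of s t]
      by (auto simp: exits_def near_def far_def foot_def len_def rad_def split: if_splits simp del: nonneg)
  next
    case (second s t u)
    then have "s \<in> M" "t \<in> M" using D_sub by auto
    with second show ?thesis using assms(2) commute[of s t]
      by (auto simp: exits_def near_def far_def foot_def len_def rad_def split: if_splits)
  qed
  then show "d (foot p) e \<le> a" "sqrt (d (foot p) e) \<le> a" by auto
qed

text \<open>Both \<open>d\<close> and \<open>sqrt d\<close> satisfy the triangle inequality and are
  bounded by \<open>rho\<close>, so the bounds at the exits add up along the detour. The bound on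
  the square root makes \<open>foot\<close> quadratically flat.\<close>

lemma foot_detour:
  assumes "p \<in> P" "q \<in> P"
  shows "d (foot p) (foot q) \<le> detour p q" "sqrt (d (foot p) (foot q)) \<le> detour p q"
proof -
  obtain a e b f where 1: "(e, a) \<in> exits p" "(f, b) \<in> exits q" "detour p q = a + rho e f + b"
    by (rule detour_cases)
  have M: "foot p \<in> M" "e \<in> M" "f \<in> M" "foot q \<in> M"
    using assms 1 exit_facts foot_in by blast+
  have r: "d e f \<le> rho e f" "sqrt (d e f) \<le> rho e f" by (auto simp: rho_def)
  show "d (foot p) (foot q) \<le> detour p q"
    using triangle[of "foot p" e "foot q"] triangle[of e f "foot q"] M r
      foot_exit[OF assms(1) 1(1)] foot_exit[OF assms(2) 1(2)] 1(3) commute[of f "foot q"] by linarith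
  show "sqrt (d (foot p) (foot q)) \<le> detour p q"
    using sqrt_triangle[of "foot p" e "foot q"] sqrt_triangle[of e f "foot q"] M r
      foot_exit[OF assms(1) 1(1)] foot_exit[OF assms(2) 1(2)] 1(3) commute[of f "foot q"] by simp
qed

text \<open>Different feet on one edge belong to opposite sides of its hole.\<close>

lemma foot_same_edge:
  assumes "p \<in> P" "q \<in> P" "same_edge p q" "foot p \<noteq> foot q"
  shows "src p \<noteq> tgt p" "d (src p) (tgt p) \<le> \<bar>ht p - ht q\<bar>"
    "d (foot p) (foot q) = d (src p) (tgt p)"
proof -
  have sl: "ht p \<in> slots (src p) (tgt p)" if "p \<in> P" for p
    using that by (auto simp: P_def slots_def rad_def)
  show ne: "src p \<noteq> tgt p" using assms(3,4) by (auto simp: foot_def same_edge_def split: if_splits)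
  show "d (foot p) (foot q) = d (src p) (tgt p)"
    using assms(3,4) commute by (auto simp: foot_def same_edge_def)
  show "d (src p) (tgt p) \<le> \<bar>ht p - ht q\<bar>"
    using assms(3,4) sl[OF assms(1)] sl[OF assms(2)] ne
    by (auto simp: foot_def same_edge_def slots_def split: if_splits)
qed

lemma foot_Lip:
  assumes "p \<in> P" "q \<in> P"
  shows "d (foot p) (foot q) \<le> glue_dist p q"
proof (cases "same_edge p q \<and> foot p \<noteq> foot q")
  case True
  then show ?thesis using foot_same_edge[OF assms] by (simp add: glue_dist_def)
next
  case False
  then show ?thesis using foot_detour[OF assms] foot_in[OF assms(2)] by (auto simp: glue_dist_def)
qed

text \<open>The radius excludes the opposite half of the edge of \<open>p\<close>.\<close>
lemma foot_locally_quadratic: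
  assumes "p \<in> P"
  obtains \<delta> where "\<delta> > 0" "\<And>q. q \<in> P \<Longrightarrow> glue_dist p q < \<delta> \<Longrightarrow> d (foot p) (foot q) \<le> (glue_dist p q)\<^sup>2"
proof
  let ?\<delta> = "if src p = tgt p then 1 else d (src p) (tgt p)"
  show "?\<delta> > 0" using P_facts(1,2)[OF assms] nonneg[of "src p" "tgt p"] zero[of "src p" "tgt p"]
    by (auto simp: less_le)
  fix q assume q: "q \<in> P" "glue_dist p q < ?\<delta>"
  show "d (foot p) (foot q) \<le> (glue_dist p q)\<^sup>2"
  proof (cases "same_edge p q")
    case True
    then have "foot p = foot q"
      using foot_same_edge(1,2)[OF assms q(1) True] q(2) by (fastforce simp: glue_dist_def split: if_splits)
    then show ?thesis using foot_in[OF q(1)] by simp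
  next
    case False
    then show ?thesis
      using power_mono[OF foot_detour(2)[OF assms q(1)], of 2] by (simp add: glue_dist_def)
  qed
qed

section \<open>Edges as 1-Lipschitz curves\<close>

lemma glue_dist_le_detour: "p \<in> P \<Longrightarrow> q \<in> P \<Longrightarrow> glue_dist p q \<le> detour p q"
  using detour_ge_same[of p q] by (simp add: glue_dist_def)

lemma glue_dist_base: "x \<in> M \<Longrightarrow> y \<in> M \<Longrightarrow> glue_dist (mk x x 0) (mk y y 0) \<le> rho x y"
  using glue_dist_le_detour[OF base_in base_in, of x y] detour_le(1)[of "mk x x 0" "mk y y 0"]
  by (simp add: near_def)

text \<open>Unlike \<open>mk\<close>, this also parametrizes the ends of the edge correctly.\<close>
definition pt :: "'a \<Rightarrow> 'a \<Rightarrow> real \<Rightarrow> (nat \<Rightarrow> 'a \<times> real)" where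
  "pt s t u = (if u = 0 then mk s s 0 else if u = len s t then mk t t 0 else mk s t u)"

lemma slots_bounds:
  assumes "u \<in> slots s t"
  shows "0 \<le> u" "u \<le> len s t" "s = t \<Longrightarrow> u < len s t"
proof -
  have "0 \<le> u \<and> u \<le> rad s t \<or> s \<noteq> t \<and> rad s t + d s t \<le> u \<and> u \<le> len s t"
    using assms by (auto simp: slots_def split: if_splits)
  moreover have "0 \<le> d s t" "0 \<le> rad s t" by (auto simp: rad_def)
  ultimately show "0 \<le> u" "u \<le> len s t" unfolding len_def by linarith+
  assume "s = t"
  moreover from this have "u \<le> 1" using assms by (simp add: slots_def rad_def)
  ultimately show "u < len s t" using \<open>0 \<le> d s t\<close> by (simp add: len_def rad_def del: nonneg)
qed

lemma len_pos: "s \<in> M \<Longrightarrow> t \<in> M \<Longrightarrow> 0 < len s t"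
  using zero[of s t] nonneg[of s t] by (cases "s = t") (auto simp: len_def rad_def add_nonneg_eq_0_iff less_le)

lemma pt_in:
  assumes "s \<in> D" "t \<in> D" "u \<in> slots s t"
  shows "pt s t u \<in> P"
proof (cases "u = 0 \<or> u = len s t")
  case True
  then show ?thesis using assms D_sub base_in by (auto simp: pt_def)
next
  case False
  then have "0 < u" "u < len s t" using slots_bounds[OF assms(3)] by auto
  then show ?thesis using assms False unfolding pt_def P_def by auto
qed

text \<open>The ends are base points and, unless \<open>s = t\<close>, do not carry the labels of
  the edge, so distances to them are bounded by detours. The far end is a slot only if
  \<open>s\<close> and \<open>t\<close> differ.\<close>

lemma glue_dist_pt_le:
  assumes st: "s \<in> D" "t \<in> D" and "u \<in> slots s t" "v \<in> slots s t"
  shows "glue_dist (pt s t u) (pt s t v) \<le> \<bar>u - v\<bar>"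
proof -
  have *: "glue_dist (pt s t u) (pt s t v) \<le> v - u" if uv: "u \<in> slots s t" "v \<in> slots s t" "u \<le> v" for u v
  proof -
    have M: "s \<in> M" "t \<in> M" using st D_sub by auto
    have P: "pt s t u \<in> P" "pt s t v \<in> P" using pt_in st uv by auto
    note b = slots_bounds[OF uv(1)] slots_bounds[OF uv(2)]
    note le = glue_dist_le_detour[OF P] detour_le[of "pt s t u" "pt s t v"]
    consider "u = v" | "u = 0" "0 < v" "v < len s t" | "u = 0" "v = len s t" "s \<noteq> t"
      | "0 < u" "u < len s t" "v = len s t" "s \<noteq> t" | "0 < u" "u < v" "v < len s t"
      using b uv(3) by fastforce
    then show ?thesis
    proof cases
      case 1 then show ?thesis using P by simp
    next
      case 2
      then have "pt s t u = mk s s 0" "pt s t v = mk s t v" by (auto simp: pt_def)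
      then show ?thesis using le(1,2) 2 M by (simp add: near_def)
    next
      case 3
      then have "pt s t u = mk s s 0" "pt s t v = mk t t 0" using len_pos[OF M] by (auto simp: pt_def)
      then show ?thesis using glue_dist_base[OF M] 3 by (simp add: rho_def len_def rad_def)
    next
      case 4
      then have "pt s t u = mk s t u" "pt s t v = mk t t 0" by (auto simp: pt_def)
      then show ?thesis using le(1,4) 4 M le(4) by (simp add: near_def far_def)
    next
      case 5
      then have "pt s t u = mk s t u" "pt s t v = mk s t v" by (auto simp: pt_def)
      then show ?thesis using 5 by (simp add: glue_dist_def same_edge_def)
    qed
  qed
  show ?thesis using *[of u v] *[of v u] assms pm.commute[of "pt s t u" "pt s t v"]
    by (cases "u \<le> v") auto
qed

section \<open>Completeness of the glued space\<close>

lemma P_slots: "p \<in> P \<Longrightarrow> ht p \<in> slots (src p) (tgt p)"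
  by (auto simp: P_def slots_def rad_def)

lemma P_pt: "p \<in> P \<Longrightarrow> p = pt (src p) (tgt p) (ht p)"
  using P_facts(4)[of p] P_facts(10,11)[of p] unfolding pt_def by auto

text \<open>The price of reaching the nearer end: every point off the edge is at least this far away
  (\<open>cost_le_pd\<close>), and some base point is at most this far away
  (\<open>cost_base\<close>).\<close>

definition cost :: "(nat \<Rightarrow> 'a \<times> real) \<Rightarrow> real" where "cost p = min (near p) (far p)"

lemma cost_le_pd:
  assumes "p \<in> P" "q \<in> P" "\<not> same_edge p q"
  shows "cost p \<le> glue_dist p q"
proof -
  obtain a e b f where 1: "(e, a) \<in> exits p" "(f, b) \<in> exits q" "detour p q = a + rho e f + b"
    by (rule detour_cases)
  have "cost p \<le> a" using 1(1) by (auto simp: exits_def cost_def)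
  moreover have "glue_dist p q = a + rho e f + b" using 1(3) assms(3) by (simp add: glue_dist_def)
  ultimately show ?thesis using exit_facts(2)[OF assms(2) 1(2)] rho_nonneg[of e f] by linarith
qed

lemma cost_base:
  assumes "p \<in> P"
  shows "\<exists>e\<in>M. glue_dist p (mk e e 0) \<le> cost p"
proof -
  have "(src p, cost p) \<in> exits p \<or> (tgt p, cost p) \<in> exits p"
    by (auto simp: exits_def cost_def min_def)
  then obtain e where e: "(e, cost p) \<in> exits p" by blast
  then have M: "e \<in> M" using exit_facts[OF assms] by blast
  have "(e, 0) \<in> exits (mk e e 0)" by (simp add: exits_def near_def)
  from detour_leI[OF e this] glue_dist_le_detour[OF assms base_in[OF M]] M show ?thesis by (auto intro!: bexI[of _ e])
qed

lemma rho_small: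
  assumes "e > 0"
  obtains \<delta> where "\<delta> > 0" "\<And>x y. d x y < \<delta> \<Longrightarrow> rho x y < e"
proof
  show "min (e / 2) ((e / 4)\<^sup>2) > 0" using assms by simp
  fix x y assume *: "d x y < min (e / 2) ((e / 4)\<^sup>2)"
  then have "sqrt (d x y) < e / 4" using assms by (intro real_less_lsqrt) auto
  then show "rho x y < e" using * by (simp add: rho_def)
qed

lemma closed_slots: "closed (slots s t)"
  unfolding slots_def by auto

text \<open>If the costs along a Cauchy sequence do not tend to 0, a tail cannot afford to leave one
  edge, and its heights converge in the closed set of slots. Otherwise the sequence is asymptotic to
  base points, which are Cauchy for \<open>d\<close> because \<open>foot\<close> is
  1-Lipschitz.\<close>

lemma pm_mcomplete:
  assumes mcomplete
  shows "pm.mcomplete"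
  unfolding pm.mcomplete_def
proof (intro allI impI)
  fix \<sigma> assume cau: "pm.MCauchy \<sigma>"
  have \<sigma>: "\<sigma> n \<in> P" for n using cau by (auto simp: pm.MCauchy_def)
  have C: "\<exists>N. \<forall>n n'. N \<le> n \<longrightarrow> N \<le> n' \<longrightarrow> glue_dist (\<sigma> n) (\<sigma> n') < e" if "e > 0" for e
    using cau that by (auto simp: pm.MCauchy_def)
  show "\<exists>x. limitin pm.mtopology \<sigma> x sequentially"
  proof (cases "\<exists>e>0. \<forall>N. \<exists>n\<ge>N. e \<le> cost (\<sigma> n)")
    case True
    then obtain e where e: "e > 0" "\<And>N. \<exists>n\<ge>N. e \<le> cost (\<sigma> n)" by blast
    obtain N where N: "\<And>n n'. N \<le> n \<Longrightarrow> N \<le> n' \<Longrightarrow> glue_dist (\<sigma> n) (\<sigma> n') < e" using C[OF e(1)] by blast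
    obtain n0 where n0: "N \<le> n0" "e \<le> cost (\<sigma> n0)" using e(2) by blast
    define s t u where "s = src (\<sigma> n0)" and "t = tgt (\<sigma> n0)" and "u = (\<lambda>n. ht (\<sigma> n))"
    have same: "same_edge (\<sigma> n0) (\<sigma> n)" if "N \<le> n" for n
      using cost_le_pd[OF \<sigma> \<sigma>, of n0 n] N[OF n0(1) that] n0 by linarith
    have eq: "\<sigma> n = pt s t (u n)" "u n \<in> slots s t" if "N \<le> n" for n
      using same[OF that] P_pt[OF \<sigma>[of n]] P_slots[OF \<sigma>[of n]]
      by (simp_all add: same_edge_def s_def t_def u_def)
    have pd_u: "glue_dist (\<sigma> n) (\<sigma> m) = \<bar>u n - u m\<bar>" if "N \<le> n" "N \<le> m" for n m
      using same[OF that(1)] same[OF that(2)] by (simp add: glue_dist_def same_edge_def u_def)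
    have "Cauchy (\<lambda>n. u (n + N))"
    proof (rule metric_CauchyI)
      fix r :: real assume "r > 0"
      then obtain K where K: "\<And>n n'. K \<le> n \<Longrightarrow> K \<le> n' \<Longrightarrow> glue_dist (\<sigma> n) (\<sigma> n') < r" using C by blast
      show "\<exists>K. \<forall>m\<ge>K. \<forall>n\<ge>K. dist (u (m + N)) (u (n + N)) < r"
      proof (intro exI[of _ K] allI impI)
        fix m n assume "K \<le> m" "K \<le> n"
        then show "dist (u (m + N)) (u (n + N)) < r"
          using K[of "m + N" "n + N"] pd_u[of "m + N" "n + N"] by (simp add: dist_real_def)
      qed
    qed
    then obtain l where l: "(\<lambda>n. u (n + N)) \<longlonglongrightarrow> l"
      using Cauchy_convergent convergent_def by blast
    have lsl: "l \<in> slots s t"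
      by (rule closed_sequentially[OF closed_slots _ l]) (simp add: eq)
    have D: "s \<in> D" "t \<in> D"
    proof -
      \<comment> \<open>Base points have cost 0, so \<open>\<sigma> n0\<close> is a proper edge
        point and its ends lie in \<open>D\<close>.\<close>
      have "\<sigma> n0 \<noteq> mk x x 0" for x using n0 e(1) by (auto simp: cost_def near_def)
      then show "s \<in> D" "t \<in> D" using \<sigma>[of n0] by (auto simp: P_def s_def t_def)
    qed
    have "limitin pm.mtopology \<sigma> (pt s t l) sequentially"
      unfolding pm.limit_metric_sequentially
    proof (intro conjI allI impI)
      show "pt s t l \<in> P" using pt_in D lsl by blast
      fix r :: real assume "r > 0"
      then obtain K where K: "\<And>n. K \<le> n \<Longrightarrow> dist (u (n + N)) l < r"
        using metric_LIMSEQ_D[OF l] by blast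
      have "\<sigma> n \<in> P \<and> glue_dist (\<sigma> n) (pt s t l) < r" if "n \<ge> K + N" for n
      proof -
        have "N \<le> n" "K \<le> n - N" using that by linarith+
        then show ?thesis
          using K[of "n - N"] glue_dist_pt_le[OF D eq(2)[of n] lsl] eq(1)[of n] \<sigma>[of n]
          by (simp add: dist_real_def)
      qed
      then show "\<exists>K. \<forall>n\<ge>K. \<sigma> n \<in> P \<and> glue_dist (\<sigma> n) (pt s t l) < r" by blast
    qed
    then show ?thesis by blast
  next
    case False
    then have c: "\<exists>N. \<forall>n\<ge>N. cost (\<sigma> n) < e" if "e > 0" for e
      using that by (meson not_le)
    obtain g where g: "\<And>n. g n \<in> M" "\<And>n. glue_dist (\<sigma> n) (mk (g n) (g n) 0) \<le> cost (\<sigma> n)"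
      using cost_base[OF \<sigma>] by metis
    have "MCauchy g"
      unfolding MCauchy_def
    proof (intro conjI allI impI)
      show "range g \<subseteq> M" using g by auto
      fix e :: real assume "e > 0"
      then have e: "e / 3 > 0" by simp
      obtain N1 where N1: "\<And>n. n \<ge> N1 \<Longrightarrow> cost (\<sigma> n) < e / 3" using c[OF e] by blast
      obtain N2 where N2: "\<And>n n'. N2 \<le> n \<Longrightarrow> N2 \<le> n' \<Longrightarrow> glue_dist (\<sigma> n) (\<sigma> n') < e / 3" using C[OF e] by blast
      have "d (g n) (g n') < e" if n: "n \<ge> max N1 N2" "n' \<ge> max N1 N2" for n n'
      proof -
        let ?b = "\<lambda>n. mk (g n) (g n) 0"
        have "d (g n) (g n') \<le> glue_dist (?b n) (?b n')"
          using foot_Lip[OF base_in base_in, OF g(1) g(1)] by simp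
        also have "\<dots> \<le> glue_dist (?b n) (\<sigma> n) + glue_dist (\<sigma> n) (\<sigma> n') + glue_dist (\<sigma> n') (?b n')"
          using glue_dist_triangle[OF base_in[OF g(1)[of n]] \<sigma>[of n] base_in[OF g(1)[of n']]]
            glue_dist_triangle[OF \<sigma>[of n] \<sigma>[of n'] base_in[OF g(1)[of n']]] by linarith
        also have "\<dots> < e"
          using N1[of n] N1[of n'] N2[of n n'] g(2)[of n] g(2)[of n'] n pm.commute[of "?b n" "\<sigma> n"]
          by linarith
        finally show ?thesis .
      qed
      then show "\<exists>N. \<forall>n n'. N \<le> n \<longrightarrow> N \<le> n' \<longrightarrow> d (g n) (g n') < e" by blast
    qed
    then obtain x where "limitin mtopology g x sequentially"
      using assms unfolding mcomplete_def by blast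
    then have x: "x \<in> M" "\<And>e. e > 0 \<Longrightarrow> \<exists>N. \<forall>n\<ge>N. d (g n) x < e"
      unfolding limit_metric_sequentially by (simp, meson)
    have "limitin pm.mtopology \<sigma> (mk x x 0) sequentially"
      unfolding pm.limit_metric_sequentially
    proof (intro conjI allI impI)
      show "mk x x 0 \<in> P" using base_in x by blast
      fix r :: real assume r: "r > 0"
      then obtain \<delta> where \<delta>: "\<delta> > 0" "\<And>x y. d x y < \<delta> \<Longrightarrow> rho x y < r / 2"
        using rho_small[of "r / 2"] by auto
      obtain N1 where N1: "\<And>n. n \<ge> N1 \<Longrightarrow> cost (\<sigma> n) < r / 2" using c[of "r / 2"] r by auto
      obtain N2 where N2: "\<And>n. n \<ge> N2 \<Longrightarrow> d (g n) x < \<delta>" using x(2)[OF \<delta>(1)] by auto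
      have "\<sigma> n \<in> P \<and> glue_dist (\<sigma> n) (mk x x 0) < r" if "n \<ge> max N1 N2" for n
      proof -
        have "cost (\<sigma> n) < r / 2" "rho (g n) x < r / 2"
          using N1 \<delta>(2)[OF N2] that by auto
        then show ?thesis
          using glue_dist_triangle[OF \<sigma>[of n] base_in[OF g(1)[of n]] base_in[OF x(1)]] g(2)[of n]
            glue_dist_base[OF g(1)[of n] x(1)] \<sigma>[of n] by linarith
      qed
      then show "\<exists>K. \<forall>n\<ge>K. \<sigma> n \<in> P \<and> glue_dist (\<sigma> n) (mk x x 0) < r" by blast
    qed
    then show ?thesis by blast
  qed
qed

subsection \<open>The curve-flat pseudometric\<close>

definition N :: "(nat \<Rightarrow> 'a \<times> real) metric" where "N = metric (P, glue_dist)"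

lemma mspace_N [simp]: "mspace N = P" and mdist_N [simp]: "mdist N = glue_dist"
  by (simp_all add: N_def)

lemma mcomplete_N: "mcomplete \<Longrightarrow> mcomplete_of N"
  using pm_mcomplete by (simp add: mcomplete_of_def)

text \<open>A fragment whose domain is a whole interval has no gap.\<close>

lemma cf_pt_free:
  assumes st: "s \<in> D" "t \<in> D" and uv: "u \<le> v" "{u..v} \<subseteq> slots s t"
  shows "cf_dist N (pt s t u) (pt s t v) = 0"
proof -
  have l: "cf_link N {u..v} (pt s t) (pt s t u) (pt s t v)" "Inf {u..v} = u" "Sup {u..v} = v"
  proof (rule cf_linkI[of _ u v]; (rule refl)?)+
    show "pt s t \<in> {u..v} \<rightarrow> mspace N" using pt_in[OF st] uv by auto
    show "mdist N (pt s t a) (pt s t b) \<le> b - a" if "a \<in> {u..v}" "b \<in> {u..v}" "a \<le> b" for a b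
    proof -
      have "a \<in> slots s t" "b \<in> slots s t" using that uv by auto
      then show ?thesis using glue_dist_pt_le[OF st, of a b] that(3) by simp
    qed
  qed (use uv in auto)
  have "u \<in> slots s t" "v \<in> slots s t" using uv by auto
  then show ?thesis
    using cf_dist_le[OF l(1)] l(2,3) cf_dist_nonneg[of "pt s t u" N "pt s t v"] pt_in[OF st] by auto
qed

lemma cf_foot:
  assumes "p \<in> P"
  shows "cf_dist N (mk (foot p) (foot p) 0) p = 0"
  using assms
proof (cases rule: P_E)
  case (base x)
  then show ?thesis using assms by (simp add: cf_dist_refl)
next
  case (first s t u)
  then have "foot p = s" by (simp add: foot_def)
  moreover have "cf_dist N (pt s t 0) (pt s t u) = 0"
    using first by (intro cf_pt_free) (auto simp: slots_def)
  ultimately show ?thesis using first by (auto simp: pt_def)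
next
  case (second s t u)
  then have ft: "foot p = t" by (simp add: foot_def)
  have "0 \<le> rad s t" by (simp add: rad_def)
  then have "0 < u" using second by simp
  moreover have "cf_dist N (pt s t u) (pt s t (len s t)) = 0"
    using second by (intro cf_pt_free) (auto simp: slots_def)
  ultimately have "cf_dist N p (mk t t 0) = 0" using second by (auto simp: pt_def)
  then show ?thesis using ft assms cf_dist_commute[of p N "mk t t 0"] base_in[of t] second D_sub
    by auto
qed

text \<open>The edge is crossed in three pieces: two free halves and a jump over the hole.\<close>

lemma cf_base_D:
  assumes st: "s \<in> D" "t \<in> D"
  shows "cf_dist N (mk s s 0) (mk t t 0) \<le> d s t"
proof (cases "s = t")
  case True
  then show ?thesis using st D_sub base_in[of t] by (auto simp: cf_dist_refl)
next
  case False
  have M: "s \<in> M" "t \<in> M" using st D_sub by auto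
  have d: "0 < d s t" using False M zero[of s t] nonneg[of s t] by (simp add: less_le)
  then have r: "0 < rad s t" using False by (simp add: rad_def)
  let ?a = "pt s t (rad s t)" and ?b = "pt s t (rad s t + d s t)"
  have sl: "0 \<in> slots s t" "rad s t \<in> slots s t" "rad s t + d s t \<in> slots s t" "len s t \<in> slots s t"
    using False d r by (auto simp: slots_def len_def)
  have ends: "pt s t 0 = mk s s 0" "pt s t (len s t) = mk t t 0"
    using len_pos[OF M] by (auto simp: pt_def)
  have P: "pt s t 0 \<in> P" "?a \<in> P" "?b \<in> P" "pt s t (len s t) \<in> P" using pt_in[OF st] sl by auto
  have "cf_dist N (pt s t 0) ?a = 0"
    using r by (intro cf_pt_free[OF st]) (auto simp: slots_def)
  moreover have "cf_dist N ?b (pt s t (len s t)) = 0"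
    using False r d by (intro cf_pt_free[OF st]) (auto simp: slots_def len_def)
  moreover have "cf_dist N ?a ?b \<le> d s t"
    using cf_dist_le_mdist[of ?a N ?b] P glue_dist_pt_le[OF st sl(2,3)] by simp
  ultimately show ?thesis
    using cf_dist_triangle[of "pt s t 0" N ?a "pt s t (len s t)"]
      cf_dist_triangle[of ?a N ?b "pt s t (len s t)"] P ends by simp
qed

text \<open>Feet need not lie in \<open>D\<close>, so the chain runs from \<open>p\<close> to its
  foot \<open>x\<close>, to a nearby \<open>s\<close> in \<open>D\<close>, along an edge to
  \<open>t\<close>, to the foot \<open>y\<close> of \<open>q\<close>, and to \<open>q\<close>. The
  jumps to and from \<open>D\<close> cost less than \<open>e / 4\<close> each, and
  \<open>d s t\<close> exceeds \<open>d x y\<close> by less than \<open>e / 2\<close>.\<close>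

lemma cf_upper:
  assumes dense: "\<And>x e. x \<in> M \<Longrightarrow> e > 0 \<Longrightarrow> \<exists>s\<in>D. d x s < e"
    and pq: "p \<in> P" "q \<in> P"
  shows "cf_dist N p q \<le> d (foot p) (foot q)"
proof (rule field_le_epsilon)
  fix e :: real assume "e > 0"
  then have e: "e / 4 > 0" by simp
  define x y where "x = foot p" and "y = foot q"
  let ?b = "\<lambda>x. mk x x 0"
  have M: "x \<in> M" "y \<in> M" using pq foot_in by (auto simp: x_def y_def)
  obtain \<delta> where \<delta>: "\<delta> > 0" "\<And>x y. d x y < \<delta> \<Longrightarrow> rho x y < e / 4" using rho_small[OF e] by blast
  obtain s where s: "s \<in> D" "d x s < min \<delta> (e / 4)" using dense[OF M(1), of "min \<delta> (e / 4)"] \<delta>(1) e by auto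
  obtain t where t: "t \<in> D" "d y t < min \<delta> (e / 4)" using dense[OF M(2), of "min \<delta> (e / 4)"] \<delta>(1) e by auto
  have st: "s \<in> M" "t \<in> M" using s t D_sub by auto
  have b: "?b x \<in> P" "?b y \<in> P" "?b s \<in> P" "?b t \<in> P" using M st base_in by auto
  have "cf_dist N (?b x) (?b s) \<le> e / 4"
    using cf_dist_le_mdist[of "?b x" N "?b s"] b glue_dist_base[OF M(1) st(1)] \<delta>(2)[of x s] s by simp
  moreover have "cf_dist N (?b t) (?b y) \<le> e / 4"
    using cf_dist_le_mdist[of "?b t" N "?b y"] b glue_dist_base[OF st(2) M(2)] \<delta>(2)[of t y] t commute[of t y] by simp
  moreover have "cf_dist N (?b s) (?b t) \<le> d s t" using cf_base_D s t by blast
  moreover have "d s t \<le> d x y + e / 2"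
    using triangle[of s x t] triangle[of x y t] M st s t commute[of s x] by simp
  moreover have "cf_dist N p (?b x) = 0"
    using cf_foot[OF pq(1)] cf_dist_commute[of p N "?b x"] pq b by (simp add: x_def)
  moreover have "cf_dist N (?b y) q = 0" using cf_foot[OF pq(2)] by (simp add: y_def)
  moreover have "cf_dist N p q \<le> cf_dist N p (?b x) + cf_dist N (?b x) (?b s) + cf_dist N (?b s) (?b t)
      + cf_dist N (?b t) (?b y) + cf_dist N (?b y) q"
    using cf_dist_triangle[of p N "?b x" q] cf_dist_triangle[of "?b x" N "?b s" q]
      cf_dist_triangle[of "?b s" N "?b t" q] cf_dist_triangle[of "?b t" N "?b y" q] pq b by simp
  ultimately show "cf_dist N p q \<le> d (foot p) (foot q) + e" by (simp add: x_def y_def)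
qed

lemma cf_lower:
  assumes l: "cf_link N K \<phi> p q"
  shows "d (foot p) (foot q) \<le> cf_gap K"
proof -
  note L = cf_linkD[OF l]
  have P: "\<phi> t \<in> P" if "t \<in> K" for t using L(5) that by auto
  have pq: "p \<in> P" "q \<in> P" using P[OF L(2)] P[OF L(3)] L(7,8) by auto
  define f where "f t = d (foot p) (foot (\<phi> t))" for t
  have diff: "\<bar>f s - f t\<bar> \<le> d (foot (\<phi> s)) (foot (\<phi> t))" if "s \<in> K" "t \<in> K" for s t
    using triangle[of "foot p" "foot (\<phi> s)" "foot (\<phi> t)"] triangle[of "foot p" "foot (\<phi> t)" "foot (\<phi> s)"]
      commute[of "foot (\<phi> s)" "foot (\<phi> t)"] foot_in P that pq by (simp add: f_def)
  have "f (Sup K) - f (Inf K) \<le> cf_gap K"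
  proof (rule zero_derivative_on_compact_increment)
    show "compact K" "K \<noteq> {}" using L(1,2) by auto
    show "\<bar>f x - f y\<bar> \<le> \<bar>x - y\<bar>" if "x \<in> K" "y \<in> K" for x y
      using diff[OF that] foot_Lip[OF P[OF that(1)] P[OF that(2)]] L(6)[OF that] by simp
    fix x assume x: "x \<in> K"
    obtain \<delta> where \<delta>: "\<delta> > 0"
      "\<And>q. q \<in> P \<Longrightarrow> glue_dist (\<phi> x) q < \<delta> \<Longrightarrow> d (foot (\<phi> x)) (foot q) \<le> (glue_dist (\<phi> x) q)\<^sup>2"
      using foot_locally_quadratic[OF P[OF x]] by blast
    show "(f has_real_derivative 0) (at x within K)"
      unfolding has_field_derivative_def has_derivative_within_alt
    proof (intro conjI allI impI)
      fix e :: real assume e: "e > 0"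
      \<comment> \<open>Below \<open>\<delta>\<close> the increment is at most the square of
        \<open>\<bar>y - x\<bar>\<close>; below \<open>e\<close> that square is at most
        \<open>e\<close> times \<open>\<bar>y - x\<bar>\<close>.\<close>
      have "norm (f y - f x - 0 * (y - x)) \<le> e * norm (y - x)" if y: "y \<in> K" "norm (y - x) < min \<delta> e" for y
      proof -
        have n: "glue_dist (\<phi> x) (\<phi> y) \<le> \<bar>y - x\<bar>" using L(6)[OF x y(1)] by (simp add: abs_minus_commute)
        then have "d (foot (\<phi> x)) (foot (\<phi> y)) \<le> (glue_dist (\<phi> x) (\<phi> y))\<^sup>2"
          using \<delta>(2)[OF P[OF y(1)]] y(2) by simp
        also have "\<dots> \<le> \<bar>y - x\<bar>\<^sup>2" using n by (intro power_mono) auto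
        also have "\<dots> \<le> e * \<bar>y - x\<bar>" using y(2) unfolding power2_eq_square by (intro mult_right_mono) auto
        finally show ?thesis using diff[OF x y(1)] by simp
      qed
      then show "\<exists>d>0. \<forall>y\<in>K. norm (y - x) < d \<longrightarrow> norm (f y - f x - 0 * (y - x)) \<le> e * norm (y - x)"
        using \<delta>(1) e by (intro exI[of _ "min \<delta> e"]) auto
    qed (rule bounded_linear_mult_right)
  qed
  then show ?thesis using L(7,8) foot_in[OF pq(1)] by (simp add: f_def)
qed

lemma cf_dist_N:
  assumes dense: "\<And>x e. x \<in> M \<Longrightarrow> e > 0 \<Longrightarrow> \<exists>s\<in>D. d x s < e"
    and pq: "p \<in> P" "q \<in> P"
  shows "cf_dist N p q = d (foot p) (foot q)"
proof (rule antisym)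
  show "d (foot p) (foot q) \<le> cf_dist N p q"
    unfolding cf_dist_link
  proof (rule cInf_greatest)
    show "{cf_gap K |K \<phi>. cf_link N K \<phi> p q} \<noteq> {}" using cf_link_exists[of p N q] pq by auto
  qed (use cf_lower in auto)
qed (rule cf_upper[OF assms])

section \<open>Rectifiability and dense subsets of the glued space\<close>

lemma not_purely_1_unrectifiable_N:
  assumes "s \<in> D"
  shows "\<not> purely_1_unrectifiable N"
proof -
  \<comment> \<open>The loop at \<open>s\<close> contains an isometric copy of
    \<open>{0<..1}\<close>.\<close>
  have "mk s s u \<in> P" if "u \<in> {0<..1}" for u
    using that assms D_sub nonneg[of s s] by (force simp: P_def slots_def rad_def len_def)
  then have "bi_Lipschitz_on {0<..1} N (mk s s)"
    unfolding bi_Lipschitz_on_def by (auto simp: glue_dist_def same_edge_def intro!: exI[of _ 1])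
  then have "\<exists>A f. A \<in> sets lebesgue \<and> emeasure lebesgue A > 0 \<and> bi_Lipschitz_on A N f"
    by (intro exI[of _ "{0<..1}"] exI[of _ "mk s s"]) auto
  then show ?thesis by (simp add: purely_1_unrectifiable_def)
qed

text \<open>Edge points are approximated by rational heights: from below on a first half and from
  above on a second half, since the other side may be the hole. Base points are approximated by base
  points of \<open>D\<close>.\<close>

lemma dense_N:
  assumes dense: "\<And>x e. x \<in> M \<Longrightarrow> e > 0 \<Longrightarrow> \<exists>s\<in>D. d x s < e"
  shows "dense_subset N (P \<inter> (\<lambda>(s, t, u). mk s t u) ` (D \<times> D \<times> \<rat>))"
  unfolding dense_subset_iff mspace_N mdist_N
proof (intro conjI ballI allI impI)
  let ?E = "P \<inter> (\<lambda>(s, t, u). mk s t u) ` (D \<times> D \<times> \<rat>)"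
  fix p and e :: real assume p: "p \<in> P" and e: "e > 0"
  have edge: "\<exists>q\<in>?E. glue_dist p q < e" if "p = mk s t u" "s \<in> D" "t \<in> D" "a < b"
    "\<And>v. a < v \<Longrightarrow> v < b \<Longrightarrow> v \<in> slots s t \<and> 0 < v \<and> v < len s t \<and> \<bar>u - v\<bar> < e" for s t u a b
  proof -
    obtain v where v: "v \<in> \<rat>" "a < v" "v < b" using Rats_dense_in_real[OF \<open>a < b\<close>] by blast
    then have "mk s t v \<in> ?E" using that(5)[OF v(2,3)] that(2,3) by (force simp: P_def)
    moreover have "glue_dist p (mk s t v) < e" using that(1) that(5)[OF v(2,3)] by (simp add: glue_dist_def same_edge_def)
    ultimately show ?thesis by blast
  qed
  show "\<exists>q\<in>?E. glue_dist p q < e"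
    using p
  proof (cases rule: P_E)
    case (base x)
    obtain \<delta> where \<delta>: "\<delta> > 0" "\<And>x y. d x y < \<delta> \<Longrightarrow> rho x y < e" using rho_small[OF e] by blast
    obtain s where s: "s \<in> D" "d x s < \<delta>" using dense[OF base(1) \<delta>(1)] by blast
    then have "s \<in> M" using D_sub by auto
    then have "mk s s 0 \<in> ?E" using s base_in by force
    moreover have "glue_dist p (mk s s 0) < e" using glue_dist_base[OF base(1) \<open>s \<in> M\<close>] base(2) \<delta>(2)[OF s(2)] by simp
    ultimately show ?thesis by blast
  next
    case (first s t u)
    show ?thesis
      by (rule edge[OF first(6,1,2), of "max 0 (u - e)" u]) (use first e in \<open>auto simp: slots_def\<close>)
  next
    case (second s t u)
    have "0 \<le> rad s t" by (simp add: rad_def)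
    then have "0 < u" using second by simp
    then show ?thesis
      by (intro edge[OF second(7,1,2), of u "min (len s t) (u + e)"])
        (use second e in \<open>auto simp: slots_def\<close>)
  qed
qed (rule Int_lower1)

text \<open>As \<open>foot\<close> is 1-Lipschitz and fixes the base points, density passes down to
  the given space; this bounds the density character of \<open>N\<close> from below.\<close>

lemma dense_foot:
  assumes "dense_subset N E"
  shows "foot ` E \<subseteq> M" "\<And>x e. x \<in> M \<Longrightarrow> e > 0 \<Longrightarrow> \<exists>s\<in>foot ` E. d x s < e"
proof -
  have E: "E \<subseteq> P" "\<And>p e. p \<in> P \<Longrightarrow> e > 0 \<Longrightarrow> \<exists>q\<in>E. glue_dist p q < e"
    using assms unfolding dense_subset_iff mspace_N mdist_N by blast+
  from E(1) show "foot ` E \<subseteq> M" using foot_in by blast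
  fix x and e :: real assume "x \<in> M" "e > 0"
  then obtain q where q: "q \<in> E" "glue_dist (mk x x 0) q < e" using E(2)[OF base_in[OF \<open>x \<in> M\<close>] \<open>e > 0\<close>] by blast
  then have "d x (foot q) < e"
    using foot_Lip[OF base_in[OF \<open>x \<in> M\<close>] subsetD[OF E(1) q(1)]] by simp
  then show "\<exists>s\<in>foot ` E. d x s < e" using q(1) by blast
qed

end

section \<open>Density character\<close>

lemma card_Times_Times_Rats_ordLeq:
  assumes "Card_order \<kappa>" "cinfinite \<kappa>" "|D| \<le>o \<kappa>"
  shows "|D \<times> D \<times> (\<rat> :: real set)| \<le>o \<kappa>"
proof -
  have inf: "\<not> finite (Field \<kappa>)" using assms(2) by (simp add: cinfinite_def)
  have "|\<rat> :: real set| \<le>o |UNIV :: nat set|"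
    by (rule card_of_ordLeqI[OF inj_on_to_nat_on[OF countable_rat]]) simp
  moreover have "|UNIV :: nat set| \<le>o \<kappa>"
    using ordIso_ordLeq_trans[OF card_of_nat natLeq_ordLeq_cinfinite] assms(1,2) by blast
  ultimately have "|\<rat> :: real set| \<le>o \<kappa>" by (rule ordLeq_transitive)
  then show ?thesis
    by (intro card_of_Times_ordLeq_infinite_Field[OF inf] assms)
qed

theorem theorem6:
  fixes M :: "'a metric"
  assumes "mspace M \<noteq> {}" and "mcomplete_of M"
  shows "\<exists>N :: (nat \<Rightarrow> 'a \<times> real) metric.
    mcomplete_of N \<and>
    \<not> purely_1_unrectifiable N \<and>
    (\<exists>\<kappa> :: ('a + nat) rel. density_character M \<kappa> \<and> density_character N \<kappa>) \<and>
    isometric_to (cf_quotient N) M"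
proof -
  obtain \<kappa> :: "('a + nat) rel" where \<kappa>: "density_character M \<kappa>"
    using density_character_exists by blast
  then obtain D where D: "dense_subset M D" "|D| \<le>o \<kappa>" and card: "Card_order \<kappa>" "cinfinite \<kappa>"
    by (auto simp: density_character_def)
  have sub: "D \<subseteq> mspace M" and dense: "\<And>x e. x \<in> mspace M \<Longrightarrow> e > 0 \<Longrightarrow> \<exists>s\<in>D. mdist M x s < e"
    using D(1) by (auto simp: dense_subset_iff)
  interpret E: edge_space "mspace M" "mdist M" D
    by (intro edge_space.intro Metric_space_mspace_mdist edge_space_axioms.intro sub)
  \<comment> \<open>Some point of \<open>D\<close> is needed to carry a loop.\<close>
  obtain s where s: "s \<in> D" using assms(1) dense[of _ 1] by force
  let ?E = "E.P \<inter> (\<lambda>(s, t, u). mk s t u) ` (D \<times> D \<times> \<rat>)"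
  have "|?E| \<le>o |(\<lambda>(s, t, u). mk s t u) ` (D \<times> D \<times> (\<rat> :: real set))|"
    by (rule card_of_mono1) auto
  moreover have "|D \<times> D \<times> (\<rat> :: real set)| \<le>o \<kappa>"
    by (rule card_Times_Times_Rats_ordLeq[OF card D(2)])
  ultimately have small: "|?E| \<le>o \<kappa>"
    using ordLeq_transitive card_of_image by metis
  have "density_character E.N \<kappa>"
    unfolding density_character_def
  proof (intro conjI allI impI)
    show "\<exists>E. dense_subset E.N E \<and> |E| \<le>o \<kappa>" using E.dense_N[OF dense] small by blast
    fix \<kappa>' :: "('a + nat) rel"
    assume *: "Card_order \<kappa>' \<and> cinfinite \<kappa>' \<and> (\<exists>E. dense_subset E.N E \<and> |E| \<le>o \<kappa>')"
    then obtain E where E: "dense_subset E.N E" "|E| \<le>o \<kappa>'" by blast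
    have "dense_subset M (E.foot ` E)" using E.dense_foot[OF E(1)] by (simp add: dense_subset_iff)
    moreover have "|E.foot ` E| \<le>o \<kappa>'" using ordLeq_transitive[OF card_of_image E(2)] .
    ultimately show "\<kappa> \<le>o \<kappa>'" using \<kappa> * unfolding density_character_def by blast
  qed (use card in auto)
  moreover have "mcomplete_of E.N" using E.mcomplete_N assms(2) by (simp add: mcomplete_of_def)
  moreover have "isometric_to (cf_quotient E.N) M"
  proof (rule isometric_to_cf_quotient)
    show "cf_dist E.N p q = mdist M (E.foot p) (E.foot q)" if "p \<in> mspace E.N" "q \<in> mspace E.N" for p q
      using E.cf_dist_N[OF dense] that by simp
    show "\<exists>p\<in>mspace E.N. E.foot p = x" if "x \<in> mspace M" for x
      using E.base_in[OF that] by (intro bexI[of _ "mk x x 0"]) auto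
  qed (use E.foot_in in simp)
  ultimately show ?thesis
    using E.not_purely_1_unrectifiable_N[OF s] \<kappa> by blast
qed

end
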